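(* Let $f$ be a standard function with $q$ poles and $\ell$ jumps. Then $f\in\mathcal{S}_\kappa$ with $\kappa=q+\ell$, and $$q+\ell\le N(f)\le q+2\ell,$$ where $N(f)=\min\{n:\ \mathbf{k}_n(f)=\kappa\}$.
   Context: $\mathbb{D}$ is the open unit disk. A Schur function is an analytic $S:\mathbb{D}\to\mathbb{C}$ with $|S|\le1$. A (finite) Blaschke product is a rational function analytic on $\mathbb{D}$ and unimodular on the unit circle; its degree is its number of zeros in $\mathbb{D}$ with multiplicity. Pick matrix: $P_n(f;z_1,\dots,z_n)=\left[\frac{1-f(z_i)\overline{f(z_j)}}{1-z_i\overline{z_j}}\right]_{i,j=1}^n$ for distinct $z_i\in\mathrm{Dom}(f)$. $\mathrm{sq}_-P$ = number of negative eigenvalues (with multiplicity) of a Hermitian $P$. $\mathbf{k}_n(f)=\max\mathrm{sq}_-P_n(f;z_1,\dots,z_n)$ over distinct $z_1,\dots,z_n\in\mathrm{Dom}(f)$. $\mathcal{S}_\kappa$: functions defined on $\mathbb{D}\setminus\Lambda$, $\Lambda$ discrete (at most countable, accumulating only on the unit circle), all of whose Pick matrices have at most $\kappa$ negative eigenvalues, with at least one having exactly $\kappa$. A standard function is $f(z)=S(z)/B(z)$ for $z\notin\mathcal{W}\cup\mathcal{Z}$, $f(z_j)=\gamma_j$ for $z_j\in\mathcal{Z}$, where $\mathcal{Z}=\{z_1,\dots,z_\ell\}$, $\mathcal{W}=\{w_1,\dots,w_p\}$ are disjoint sets of distinct points of $\mathbb{D}$; $\gamma_j\in\mathbb{C}$;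 $B$ is a Blaschke product of degree $q\ge0$, $S$ a Schur function, $\mathcal{W}\subseteq Z(B)\subseteq\mathcal{W}\cup\mathcal{Z}$, $Z(B)\cap Z(S)=\emptyset$; and $S(z_j)/B(z_j)\ne\gamma_j$ whenever $z_j\in\mathcal{Z}\setminus Z(B)$. Its domain is $\mathbb{D}\setminus\mathcal{W}$; it has $q$ poles (zeros of $B$ with multiplicity) and $\ell$ jumps $z_1,\dots,z_\ell$. *)

theory Defs
  imports "HOL-Complex_Analysis.Complex_Analysis" "Jordan_Normal_Form.Char_Poly"
begin

text \<open>Number of negative eigenvalues (with algebraic multiplicity) of a square
  complex matrix; for Hermitian matrices all eigenvalues are real.\<close>
definition sq_minus :: "complex mat \<Rightarrow> nat" where
  "sq_minus P = (\<Sum>a\<in>{a::real. a < 0 \<and> poly (char_poly P) (complex_of_real a) = 0}.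
                    order (complex_of_real a) (char_poly P))"

definition pick_matrix :: "(complex \<Rightarrow> complex) \<Rightarrow> complex list \<Rightarrow> complex mat" where
  "pick_matrix f zs = Matrix.mat (length zs) (length zs)
     (\<lambda>(i,j). (1 - f (zs!i) * cnj (f (zs!j))) / (1 - zs!i * cnj (zs!j)))"

definition kn :: "complex set \<Rightarrow> (complex \<Rightarrow> complex) \<Rightarrow> nat \<Rightarrow> nat" where
  "kn D f n = Max {sq_minus (pick_matrix f zs) | zs.
       length zs = n \<and> distinct zs \<and> set zs \<subseteq> D}"

definition in_S_kappa :: "complex set \<Rightarrow> (complex \<Rightarrow> complex) \<Rightarrow> nat \<Rightarrow> bool" where
  "in_S_kappa D f \<kappa> \<longleftrightarrow>
     (\<exists>\<Lambda>. \<Lambda> \<subseteq> ball 0 1 \<and> (\<forall>z\<in>ball 0 1. \<not> z islimpt \<Lambda>) \<and> D = ball 0 1 - \<Lambda>) \<and>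
     (\<forall>zs. distinct zs \<and> set zs \<subseteq> D \<longrightarrow> sq_minus (pick_matrix f zs) \<le> \<kappa>) \<and>
     (\<exists>zs. distinct zs \<and> set zs \<subseteq> D \<and> sq_minus (pick_matrix f zs) = \<kappa>)"

definition N_index :: "complex set \<Rightarrow> (complex \<Rightarrow> complex) \<Rightarrow> nat \<Rightarrow> nat" where
  "N_index D f \<kappa> = (LEAST n. kn D f n = \<kappa>)"

definition schur_function :: "(complex \<Rightarrow> complex) \<Rightarrow> bool" where
  "schur_function S \<longleftrightarrow> S holomorphic_on ball 0 1 \<and> (\<forall>z\<in>ball 0 1. norm (S z) \<le> 1)"

definition blaschke_product :: "(complex \<Rightarrow> complex) \<Rightarrow> nat \<Rightarrow> bool" where
  "blaschke_product B q \<longleftrightarrow>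
     (\<exists>c as. norm c = 1 \<and> length as = q \<and> (\<forall>a\<in>set as. norm a < 1) \<and>
        (\<forall>z. norm z \<le> 1 \<longrightarrow> B z = c * (\<Prod>a\<leftarrow>as. (z - a) / (1 - cnj a * z))))"

definition zeroset :: "(complex \<Rightarrow> complex) \<Rightarrow> complex set" where
  "zeroset g = {z\<in>ball 0 1. g z = 0}"

text \<open>f is a standard function with Schur part S, Blaschke product B of degree q,
  jump set Z, and singular set W; its domain is the disk minus W.
  The jump values gamma_j are the values f(z_j).\<close>
definition standard_function ::
  "(complex \<Rightarrow> complex) \<Rightarrow> (complex \<Rightarrow> complex) \<Rightarrow> (complex \<Rightarrow> complex) \<Rightarrow> nat \<Rightarrow>
   complex set \<Rightarrow> complex set \<Rightarrow> bool" where
  "standard_function f S B q Z W \<longleftrightarrow>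
     finite Z \<and> finite W \<and> Z \<subseteq> ball 0 1 \<and> W \<subseteq> ball 0 1 \<and> Z \<inter> W = {} \<and>
     schur_function S \<and> blaschke_product B q \<and>
     W \<subseteq> zeroset B \<and> zeroset B \<subseteq> W \<union> Z \<and> zeroset B \<inter> zeroset S = {} \<and>
     (\<forall>z\<in>Z - zeroset B. f z \<noteq> S z / B z) \<and>
     (\<forall>z\<in>ball 0 1 - (W \<union> Z). f z = S z / B z)"

end

theory Submission
  imports Defs "Jordan_Normal_Form.Schur_Decomposition"
begin

text \<open>
  The Hermitian form of the Pick matrix at points \<open>z\<^sub>i\<close> is
  \<open>Q(c) = \<Sum>m. |\<Sum>i. c\<^sub>i z\<^sub>i ^ m|\<^sup>2 - |\<Sum>i. c\<^sub>i f(z\<^sub>i) z\<^sub>i ^ m|\<^sup>2\<close>.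

  Upper bound: imposing \<open>c\<^sub>i = 0\<close> at the jumps costs \<open>\<ell>\<close> dimensions. Away from them, with
  \<open>c\<^sub>i = B(z\<^sub>i) e\<^sub>i\<close>, the form is that of the positive Szego-type kernel of \<open>S\<close> minus that of
  the kernel of \<open>B\<close>, and the latter has rank \<open>q\<close>.

  Lower bound: let \<open>N = q + \<ell>\<close> nodes \<open>t\<^sub>1, \<dots>, t\<^sub>N\<close> tend to the list \<open>a\<close> consisting of the zeros
  of \<open>B\<close> (with multiplicity) and the jumps. For a polynomial \<open>p\<close> of degree less than \<open>N\<close>, the
  functional \<open>h \<mapsto> (2\<pi>\<i>)\<^sup>-\<^sup>1 \<integral> p h / \<Prod>\<^sub>i (u - t\<^sub>i) du\<close> is a combination of evaluations at
  the nodes and depends continuously on \<open>t\<close>, even where nodes collide (a divided difference). Applied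
  to \<open>B u ^ m\<close> its limit is a combination of evaluations at the jumps, which is cancelled by
  the coefficients put on the jumps; applied to \<open>S u ^ m\<close>, with the same correction, the limit
  vanishes for all \<open>m\<close> only if \<open>p = 0\<close>. By compactness \<open>Q\<close> is negative definite on this
  \<open>N\<close>-dimensional space once \<open>t\<close> is close to \<open>a\<close>.
\<close>

section \<open>Inertia of Hermitian matrices\<close>

unbundle no vec_syntax and no fps_syntax

section \<open>Adjoint matrices and unitary diagonalization\<close>

lemma dim_mat_adjoint [simp]:
  "dim_row (mat_adjoint A) = dim_col A" "dim_col (mat_adjoint A) = dim_row A"
  by (auto simp: mat_adjoint_def mat_of_rows_def)

lemma mat_adjoint_carrier [simp]: "A \<in> carrier_mat n m \<Longrightarrow> mat_adjoint A \<in> carrier_mat m n"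
  by (auto simp: mat_adjoint_def mat_of_rows_def)

lemma mat_adjoint_index:
  assumes "A \<in> carrier_mat n m" "i < m" "j < n"
  shows "mat_adjoint A $$ (i, j) = conjugate (A $$ (j, i))"
  using assms by (auto simp: mat_adjoint_def mat_of_rows_def)

lemma mat_adjoint_mult:
  fixes A B :: "complex mat"
  assumes "A \<in> carrier_mat n m" "B \<in> carrier_mat m k"
  shows "mat_adjoint (A * B) = mat_adjoint B * mat_adjoint A"
proof (rule eq_matI)
  show "dim_row (mat_adjoint (A * B)) = dim_row (mat_adjoint B * mat_adjoint A)"
    and "dim_col (mat_adjoint (A * B)) = dim_col (mat_adjoint B * mat_adjoint A)"
    using assms by (auto simp: mat_adjoint_def)
next
  fix i j assume "i < dim_row (mat_adjoint B * mat_adjoint A)" "j < dim_col (mat_adjoint B * mat_adjoint A)"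
  then have ij: "i < k" "j < n" using assms by (auto simp: mat_adjoint_def)
  have "mat_adjoint (A * B) $$ (i, j) = cnj ((A * B) $$ (j, i))"
    using assms ij by (subst mat_adjoint_index[of _ n k]) auto
  also have "\<dots> = (\<Sum>l<m. cnj (A $$ (j, l)) * cnj (B $$ (l, i)))"
    using assms ij by (simp add: scalar_prod_def atLeast0LessThan)
  also have "\<dots> = (\<Sum>l<m. mat_adjoint B $$ (i, l) * mat_adjoint A $$ (l, j))"
    using assms ij by (intro sum.cong refl)
      (simp add: mat_adjoint_index[OF assms(1)] mat_adjoint_index[OF assms(2)] mult.commute)
  also have "\<dots> = (mat_adjoint B * mat_adjoint A) $$ (i, j)"
    using assms ij carrier_matD[OF mat_adjoint_carrier[OF assms(1)]]
      carrier_matD[OF mat_adjoint_carrier[OF assms(2)]]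
    by (simp add: scalar_prod_def atLeast0LessThan)
  finally show "mat_adjoint (A * B) $$ (i, j) = (mat_adjoint B * mat_adjoint A) $$ (i, j)" .
qed

lemma mat_adjoint_adjoint:
  fixes A :: "complex mat"
  assumes "A \<in> carrier_mat n m"
  shows "mat_adjoint (mat_adjoint A) = A"
  using assms mat_adjoint_carrier[OF assms] mat_adjoint_carrier[OF mat_adjoint_carrier[OF assms]]
  by (intro eq_matI)
    (auto simp: mat_adjoint_index[OF assms] mat_adjoint_index[OF mat_adjoint_carrier[OF assms]])

text \<open>Gram-Schmidt applied to a basis starting with \<open>v\<close> keeps \<open>v\<close> as
  its first vector. Its output is orthogonal but not normalized, so the columns are divided by the
  norms \<open>nr\<close>.\<close>

lemma unitary_with_first_column:
  fixes v :: "complex vec"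
  assumes v: "v \<in> carrier_vec n" "v \<noteq> 0\<^sub>v n"
  shows "\<exists>W \<in> carrier_mat n n. mat_adjoint W * W = 1\<^sub>m n \<and> (\<exists>c. col W 0 = c \<cdot>\<^sub>v v)"
proof -
  have n: "0 < n" using v by (cases n) auto
  interpret cof_vec_space n "TYPE(complex)" .
  define b where "b = basis_completion v"
  define ws where "ws = gram_schmidt n b"
  from basis_completion[OF v, folded b_def]
  have dist_b: "distinct b" and indep: "\<not> lin_dep (set b)" and b: "set b \<subseteq> carrier_vec n"
    and hdb: "hd b = v" and len_b: "length b = n" by auto
  from hdb len_b n obtain vs where bv: "b = v # vs" by (cases b) auto
  from gram_schmidt_result[OF b dist_b indep refl, folded ws_def]
  have ws: "set ws \<subseteq> carrier_vec n" "corthogonal ws" "length ws = n"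
    by (auto simp: len_b)
  have hdws: "hd ws = v"
    using gram_schmidt_hd[OF v(1), of vs, folded bv] unfolding ws_def .
  have ws0: "ws ! 0 = v" using hdws ws(3) n by (cases ws) auto
  have wsc: "ws ! i \<in> carrier_vec n" if "i < n" for i using ws that by auto
  define nr where "nr i = sqrt (\<Sum>l<n. (cmod (ws ! i $ l))\<^sup>2)" for i
  have inner: "ws ! i \<bullet>c ws ! j = (\<Sum>l<n. ws ! i $ l * cnj (ws ! j $ l))" if "i < n" "j < n" for i j
    using wsc that by (auto simp: scalar_prod_def atLeast0LessThan intro!: sum.cong)
  have nr2: "complex_of_real ((nr i)\<^sup>2) = ws ! i \<bullet>c ws ! i" if "i < n" for i
    unfolding inner[OF that that] nr_def
    by (subst real_sqrt_pow2) (auto intro!: sum_nonneg sum.cong simp: complex_norm_square simp del: of_real_power)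
  have nr0: "nr i \<noteq> 0" if "i < n" for i
  proof
    assume "nr i = 0"
    then have "ws ! i \<bullet>c ws ! i = 0" using nr2[OF that] by simp
    then show False using corthogonalD[OF ws(2), of i i] that ws(3) by simp
  qed
  define W where "W = Matrix.mat n n (\<lambda>(l,i). ws ! i $ l / complex_of_real (nr i))"
  have W: "W \<in> carrier_mat n n" unfolding W_def by simp
  have "mat_adjoint W * W = 1\<^sub>m n"
  proof (rule eq_matI)
    show "dim_row (mat_adjoint W * W) = dim_row (1\<^sub>m n)" "dim_col (mat_adjoint W * W) = dim_col (1\<^sub>m n)"
      using W mat_adjoint_carrier[OF W] by auto
  next
    fix i j assume "i < dim_row (1\<^sub>m n)" "j < dim_col (1\<^sub>m n)"
    then have ij: "i < n" "j < n" by auto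
    have "(mat_adjoint W * W) $$ (i, j) = (\<Sum>l<n. mat_adjoint W $$ (i, l) * W $$ (l, j))"
      using W carrier_matD[OF mat_adjoint_carrier[OF W]] ij by (simp add: scalar_prod_def atLeast0LessThan)
    also have "\<dots> = (\<Sum>l<n. ws ! j $ l * cnj (ws ! i $ l) / (complex_of_real (nr i) * complex_of_real (nr j)))"
      using ij by (intro sum.cong refl) (simp add: mat_adjoint_index[OF W], simp add: W_def)
    also have "\<dots> = (ws ! j \<bullet>c ws ! i) / (complex_of_real (nr i) * complex_of_real (nr j))"
      unfolding inner[OF ij(2) ij(1)] by (simp add: sum_divide_distrib)
    also have "\<dots> = 1\<^sub>m n $$ (i, j)"
    proof (cases "i = j")
      case True
      then show ?thesis using nr2[OF ij(1), symmetric] nr0[OF ij(1)] ij by (simp add: power2_eq_square)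
    next
      case False
      then show ?thesis using corthogonalD[OF ws(2), of j i] ij ws(3) by simp
    qed
    finally show "(mat_adjoint W * W) $$ (i, j) = 1\<^sub>m n $$ (i, j)" .
  qed
  moreover have "col W 0 = (1 / complex_of_real (nr 0)) \<cdot>\<^sub>v v"
    using n v(1) by (intro eq_vecI) (auto simp: W_def ws0)
  ultimately show ?thesis using W by blast
qed

lemma complex_eigenvector_exists:
  fixes A :: "complex mat"
  assumes A: "A \<in> carrier_mat n n" and n: "0 < n"
  shows "\<exists>e v. v \<in> carrier_vec n \<and> v \<noteq> 0\<^sub>v n \<and> A *\<^sub>v v = e \<cdot>\<^sub>v v"
proof -
  have "degree (char_poly A) = n" using degree_monic_char_poly[OF A] by simp
  then have "\<not> constant (poly (char_poly A))" using n by (simp add: constant_degree)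
  then obtain e where "poly (char_poly A) e = 0" using fundamental_theorem_of_algebra by blast
  then have "eigenvalue A e" using eigenvalue_root_char_poly[OF A] by simp
  then show ?thesis using A unfolding eigenvalue_def eigenvector_def by auto
qed

definition diag_of_list :: "complex list \<Rightarrow> complex mat" where
  "diag_of_list es = Matrix.mat (length es) (length es) (\<lambda>(i,j). if i = j then es ! i else 0)"

lemma diag_of_list_carrier [simp]: "length es = n \<Longrightarrow> diag_of_list es \<in> carrier_mat n n"
  by (auto simp: diag_of_list_def)

lemma diag_of_list_Cons:
  "diag_of_list (e # es) =
     four_block_mat (Matrix.mat 1 1 (\<lambda>_. e)) (0\<^sub>m 1 (length es)) (0\<^sub>m (length es) 1) (diag_of_list es)"
  by (rule eq_matI) (auto simp: diag_of_list_def four_block_mat_def nth_Cons' )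

text \<open>Deflation: in a unitary basis starting with an eigenvector, the first column becomes a
  multiple of the first unit vector. Hermitian symmetry then clears the first row, and the remaining
  block \<open>A3\<close> is again Hermitian. That the entries of \<open>es\<close> are real is
  derived later, from the quadratic form.\<close>

theorem hermitian_diagonalization:
  fixes A :: "complex mat"
  assumes "A \<in> carrier_mat n n" "mat_adjoint A = A"
  shows "\<exists>U es. U \<in> carrier_mat n n \<and> length es = n \<and> mat_adjoint U * U = 1\<^sub>m n \<and>
           A = U * diag_of_list es * mat_adjoint U"
  using assms
proof (induction n arbitrary: A)
  case 0
  then have A0: "A = 1\<^sub>m 0" by (intro eq_matI) auto
  have "mat_adjoint (1\<^sub>m 0) = (1\<^sub>m 0 :: complex mat)"
    using mat_adjoint_carrier[of "1\<^sub>m 0" 0 0] by (intro eq_matI) auto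
  then show ?case using A0 by (intro exI[of _ "1\<^sub>m 0"] exI[of _ "[]"]) (auto simp: diag_of_list_def)
next
  case (Suc n A)
  note A = Suc.prems(1) and herm = Suc.prems(2)
  obtain e v where v: "v \<in> carrier_vec (Suc n)" "v \<noteq> 0\<^sub>v (Suc n)" "A *\<^sub>v v = e \<cdot>\<^sub>v v"
    using complex_eigenvector_exists[OF A] by auto
  obtain W c where W: "W \<in> carrier_mat (Suc n) (Suc n)" and WW: "mat_adjoint W * W = 1\<^sub>m (Suc n)"
    and c: "col W 0 = c \<cdot>\<^sub>v v" using unitary_with_first_column[OF v(1,2)] by blast
  note W' = mat_adjoint_carrier[OF W]
  have WW': "W * mat_adjoint W = 1\<^sub>m (Suc n)"
    using mat_mult_left_right_inverse[OF W' W WW] .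
  define A' where "A' = mat_adjoint W * (A * W)"
  have A': "A' \<in> carrier_mat (Suc n) (Suc n)" unfolding A'_def using A W W' by auto
  have hA': "mat_adjoint A' = A'"
    unfolding A'_def using A W W'
    by (simp add: mat_adjoint_mult[OF W', of _ "Suc n"] mat_adjoint_mult[OF A W] mat_adjoint_adjoint[OF W] herm assoc_mult_mat[OF W' A W])
  have "col (A * W) 0 = A *\<^sub>v col W 0" using col_mult2[OF A W, of 0] by simp
  also have "\<dots> = e \<cdot>\<^sub>v col W 0"
    unfolding c using A v by (simp add: mult_mat_vec smult_smult_assoc mult.commute)
  finally have colAW: "col (A * W) 0 = e \<cdot>\<^sub>v col W 0" .
  have "col A' 0 = mat_adjoint W *\<^sub>v col (A * W) 0"
    unfolding A'_def using col_mult2[OF W', of "A * W" "Suc n" 0] A W by simp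
  also have "\<dots> = e \<cdot>\<^sub>v (mat_adjoint W *\<^sub>v col W 0)"
    unfolding colAW by (rule mult_mat_vec[OF W']) (use W in \<open>auto intro!: carrier_vecI\<close>)
  also have "mat_adjoint W *\<^sub>v col W 0 = col (mat_adjoint W * W) 0"
    using col_mult2[OF W' W, of 0] by simp
  finally have colA': "col A' 0 = e \<cdot>\<^sub>v unit_vec (Suc n) 0" by (simp add: WW)
  have A'0: "A' $$ (i, 0) = (if i = 0 then e else 0)" if "i < Suc n" for i
    using arg_cong[OF colA', of "\<lambda>w. vec_index w i"] A' that by auto
  have A'0': "A' $$ (0, i) = 0" if "i < Suc n" "i \<noteq> 0" for i
    using mat_adjoint_index[OF A', of 0 i] A'0[of i] that by (simp add: hA')
  define A3 where "A3 = Matrix.mat n n (\<lambda>(i,j). A' $$ (Suc i, Suc j))"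
  have A3: "A3 \<in> carrier_mat n n" by (simp add: A3_def)
  have blk: "A' = four_block_mat (Matrix.mat 1 1 (\<lambda>_. e)) (0\<^sub>m 1 n) (0\<^sub>m n 1) A3"
  proof (rule eq_matI)
    fix i j assume "i < dim_row (four_block_mat (Matrix.mat 1 1 (\<lambda>_. e)) (0\<^sub>m 1 n) (0\<^sub>m n 1) A3)"
      "j < dim_col (four_block_mat (Matrix.mat 1 1 (\<lambda>_. e)) (0\<^sub>m 1 n) (0\<^sub>m n 1) A3)"
    then have "i < Suc n" "j < Suc n" using A3 by auto
    then show "A' $$ (i, j) = four_block_mat (Matrix.mat 1 1 (\<lambda>_. e)) (0\<^sub>m 1 n) (0\<^sub>m n 1) A3 $$ (i, j)"
      using A'0[of i] A'0'[of j] A3 by (cases i; cases j) (auto simp: A3_def)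
  qed (use A' A3 in auto)
  have "mat_adjoint A3 = A3"
  proof (rule eq_matI)
    fix i j assume "i < dim_row A3" "j < dim_col A3"
    then have ij: "i < n" "j < n" using A3 by auto
    then show "mat_adjoint A3 $$ (i, j) = A3 $$ (i, j)"
      using mat_adjoint_index[OF A3 ij] mat_adjoint_index[OF A', of "Suc i" "Suc j"]
      by (simp add: hA' A3_def)
  qed (use A3 mat_adjoint_carrier[OF A3] in auto)
  then obtain U es where U: "U \<in> carrier_mat n n" and es: "length es = n"
    and UU: "mat_adjoint U * U = 1\<^sub>m n" and A3eq: "A3 = U * diag_of_list es * mat_adjoint U"
    using Suc.IH[OF A3] by blast
  note U' = mat_adjoint_carrier[OF U]
  have D: "diag_of_list es \<in> carrier_mat n n" using es by simp
  \<comment> \<open>\<open>T\<close> is \<open>U\<close> bordered by a corner entry 1; the unitary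
    matrix that diagonalizes \<open>A\<close> is \<open>W * T\<close>.\<close>
  define T where "T = four_block_mat (1\<^sub>m 1) (0\<^sub>m 1 n) (0\<^sub>m n 1) U"
  define T' where "T' = four_block_mat (1\<^sub>m 1) (0\<^sub>m 1 n) (0\<^sub>m n 1) (mat_adjoint U)"
  have T: "T \<in> carrier_mat (Suc n) (Suc n)" and T': "T' \<in> carrier_mat (Suc n) (Suc n)"
    using four_block_carrier_mat[OF one_carrier_mat U, of 1] four_block_carrier_mat[OF one_carrier_mat U', of 1]
    unfolding T_def T'_def by auto
  have adjT: "mat_adjoint T = T'"
  proof (rule eq_matI)
    fix i j assume "i < dim_row T'" "j < dim_col T'"
    then have ij: "i < Suc n" "j < Suc n" using T' by auto
    have "mat_adjoint T $$ (i, j) = cnj (T $$ (j, i))" using mat_adjoint_index[OF T ij] by simp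
    also have "\<dots> = T' $$ (i, j)"
      unfolding T_def T'_def using ij U U' mat_adjoint_index[OF U] by (cases i; cases j) auto
    finally show "mat_adjoint T $$ (i, j) = T' $$ (i, j)" .
  qed (use T T' mat_adjoint_carrier[OF T] in auto)
  have TT: "T' * T = 1\<^sub>m (Suc n)"
  proof -
    have "T' * T = four_block_mat (1\<^sub>m 1) (0\<^sub>m 1 n) (0\<^sub>m n 1) (1\<^sub>m n)"
      unfolding T_def T'_def
      by (subst mult_four_block_mat[OF one_carrier_mat _ _ U' one_carrier_mat _ _ U])
        (use U U' UU in auto)
    then show ?thesis by simp
  qed
  have DT: "diag_of_list (e # es) \<in> carrier_mat (Suc n) (Suc n)" using es by simp
  have A'eq: "A' = T * diag_of_list (e # es) * T'"
  proof -
    have "T * diag_of_list (e # es) =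
       four_block_mat (Matrix.mat 1 1 (\<lambda>_. e)) (0\<^sub>m 1 n) (0\<^sub>m n 1) (U * diag_of_list es)"
      unfolding T_def diag_of_list_Cons es
      by (subst mult_four_block_mat[OF one_carrier_mat _ _ U _ _ _ D]) (use U D in auto)
    also have "\<dots> * T' = A'"
      unfolding T'_def blk A3eq
      by (subst mult_four_block_mat[OF _ _ _ mult_carrier_mat[OF U D] one_carrier_mat _ _ U'])
         (use U D U' in auto)
    finally show ?thesis by simp
  qed
  have adjWT: "mat_adjoint (W * T) = T' * mat_adjoint W"
    using mat_adjoint_mult[OF W T] adjT by simp
  have "mat_adjoint (W * T) * (W * T) = T' * (mat_adjoint W * (W * T))"
    unfolding adjWT using W T W' T' by (simp add: assoc_mult_mat[of _ "Suc n" "Suc n" _ "Suc n" _ "Suc n"])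
  also have "mat_adjoint W * (W * T) = T"
    using WW W T W' by (simp flip: assoc_mult_mat[of _ "Suc n" "Suc n" _ "Suc n" _ "Suc n"])
  finally have un: "mat_adjoint (W * T) * (W * T) = 1\<^sub>m (Suc n)" using TT by simp
  have "W * T * diag_of_list (e # es) * mat_adjoint (W * T) =
        W * (T * diag_of_list (e # es) * T') * mat_adjoint W"
    unfolding adjWT using W T W' T' DT by (simp add: assoc_mult_mat[of _ "Suc n" "Suc n" _ "Suc n" _ "Suc n"])
  also have "\<dots> = W * A' * mat_adjoint W" by (simp add: A'eq)
  also have "\<dots> = (W * mat_adjoint W) * A * (W * mat_adjoint W)"
    unfolding A'_def using A W W'
    by (simp add: assoc_mult_mat[of _ "Suc n" "Suc n" _ "Suc n" _ "Suc n"]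
        mult_carrier_mat[of _ "Suc n" "Suc n" _ "Suc n"])
  also have "\<dots> = A" using A by (simp add: WW')
  finally show ?case using un W T es
    by (intro exI[of _ "W * T"] exI[of _ "e # es"]) auto
qed

section \<open>Negative eigenvalues and dimension counts\<close>

text \<open>Gaussian elimination: when equation \<open>i\<close> has a nonzero coefficient at
  \<open>j0\<close>, this unknown is eliminated from the other equations, which lowers both
  cardinalities by one. Its value is recovered by back substitution.\<close>

lemma homogeneous_system_nontrivial:
  fixes a :: "'i \<Rightarrow> 'j \<Rightarrow> 'a :: field"
  assumes "finite I" "finite J" "card I < card J"
  shows "\<exists>x. (\<exists>j\<in>J. x j \<noteq> 0) \<and> (\<forall>i\<in>I. (\<Sum>j\<in>J. a i j * x j) = 0)"
  using assms
proof (induction I arbitrary: a J rule: finite_induct)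
  case empty
  then have "J \<noteq> {}" by auto
  then show ?case by (intro exI[of _ "\<lambda>_. 1"]) auto
next
  case (insert i I)
  show ?case
  proof (cases "\<forall>j\<in>J. a i j = 0")
    case True
    then show ?thesis using insert.IH[of J a] insert.prems insert.hyps by auto
  next
    case False
    then obtain j0 where j0: "j0 \<in> J" "a i j0 \<noteq> 0" by auto
    define b where "b k j = a k j - a k j0 * a i j / a i j0" for k j
    have "card I < card (J - {j0})" using insert j0 by simp
    then obtain x where x: "\<exists>j\<in>J - {j0}. x j \<noteq> 0" "\<forall>k\<in>I. (\<Sum>j\<in>J - {j0}. b k j * x j) = 0"
      using insert.IH[of "J - {j0}" b] insert.prems by blast
    define s where "s = (\<Sum>j\<in>J - {j0}. a i j * x j)"
    define y where "y = x(j0 := - s / a i j0)"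
    have split: "(\<Sum>j\<in>J. a k j * y j) = a k j0 * (- s / a i j0) + (\<Sum>j\<in>J - {j0}. a k j * x j)" for k
      using insert.prems(1) j0(1)
      by (subst sum.remove[of J j0]) (auto simp: y_def intro!: sum.cong)
    have "(\<Sum>j\<in>J. a k j * y j) = 0" if "k \<in> insert i I" for k
    proof (cases "k = i")
      case True
      then show ?thesis unfolding split using j0 by (simp add: s_def)
    next
      case False
      with that have "0 = (\<Sum>j\<in>J - {j0}. b k j * x j)" using x(2) by simp
      also have "\<dots> = (\<Sum>j\<in>J - {j0}. a k j * x j) - a k j0 * s / a i j0"
        unfolding b_def s_def
        by (simp add: left_diff_distrib sum_subtractf sum_distrib_left sum_divide_distrib mult.assoc)
      finally show ?thesis unfolding split by simp
    qed
    moreover have "\<exists>j\<in>J. y j \<noteq> 0" using x(1) by (auto simp: y_def)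
    ultimately show ?thesis by blast
  qed
qed

text \<open>Translates the root multiplicities in \<open>sq_minus\<close> into counts of positions
  in the list of eigenvalues.\<close>

lemma order_prod_list_linear:
  "Polynomial.order (a :: 'a :: field) (\<Prod>e\<leftarrow>es. [:- e, 1:]) = length (filter ((=) a) es)"
proof (induction es)
  case (Cons e es)
  define p where "p = (\<Prod>e\<leftarrow>es. [:- e, 1:])"
  have p: "p \<noteq> 0" by (auto simp: prod_list_zero_iff p_def)
  have lin: "Polynomial.order a [:- e, 1:] = (if a = e then 1 else 0)"
  proof (cases "a = e")
    case True
    then show ?thesis using order_power_n_n[of e 1] by simp
  next
    case False
    then show ?thesis by (simp add: order_0I)
  qed
  have "Polynomial.order a ([:- e, 1:] * p) = Polynomial.order a [:- e, 1:] + Polynomial.order a p"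
    by (rule order_mult) (use p in \<open>simp del: mult_pCons_left\<close>)
  then show ?case using Cons lin by (simp add: p_def del: mult_pCons_left)
qed simp

lemma char_poly_diag_of_list: "char_poly (diag_of_list es) = (\<Prod>e\<leftarrow>es. [:- e, 1:])"
proof -
  have "upper_triangular (diag_of_list es)" "diag_mat (diag_of_list es) = es"
    by (auto simp: diag_of_list_def diag_mat_def intro!: nth_equalityI)
  then show ?thesis using char_poly_upper_triangular[of "diag_of_list es" "length es"] by simp
qed

lemma mat_mult_index_sum:
  assumes "A \<in> carrier_mat n m" "B \<in> carrier_mat m k" "i < n" "j < k"
  shows "(A * B) $$ (i, j) = (\<Sum>l<m. A $$ (i, l) * B $$ (l, j))"
  using assms by (simp add: scalar_prod_def atLeast0LessThan)

text \<open>The conjugate sits on the second index, as in the Pick kernel: the matrix with entries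
  \<open>a i * cnj (a j)\<close> has as its form the squared modulus of the sum of
  \<open>a i * c i\<close>.\<close>

definition mat_form :: "complex mat \<Rightarrow> nat \<Rightarrow> (nat \<Rightarrow> complex) \<Rightarrow> complex" where
  "mat_form A n c = (\<Sum>i<n. \<Sum>j<n. A $$ (i, j) * c i * cnj (c j))"

text \<open>Diagonalization in coordinates: \<open>u\<close> reads off the coordinates of
  \<open>c\<close>, \<open>v\<close> builds a vector with prescribed coordinates, and
  \<open>r\<close> lists the eigenvalues. The dimension counts below use \<open>u\<close> to force
  coordinates to vanish and \<open>v\<close> to prescribe them.\<close>

lemma hermitian_inertia:
  fixes A :: "complex mat"
  assumes A: "A \<in> carrier_mat n n" and herm: "\<And>i j. i < n \<Longrightarrow> j < n \<Longrightarrow> A $$ (i, j) = cnj (A $$ (j, i))"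
  shows "\<exists>(u :: nat \<Rightarrow> nat \<Rightarrow> complex) v (r :: nat \<Rightarrow> real).
    (\<forall>c. mat_form A n c = of_real (\<Sum>k<n. r k * (cmod (\<Sum>j<n. u k j * c j))\<^sup>2)) \<and>
    (\<forall>y. \<forall>k<n. (\<Sum>j<n. u k j * (\<Sum>i<n. v j i * y i)) = y k) \<and>
    sq_minus A = card {k. k < n \<and> r k < 0}"
proof -
  have "mat_adjoint A = A"
    using A by (intro eq_matI) (auto simp: mat_adjoint_index[OF A] herm[symmetric])
  then obtain U es where U: "U \<in> carrier_mat n n" and es: "length es = n"
    and UU: "mat_adjoint U * U = 1\<^sub>m n" and Aeq: "A = U * diag_of_list es * mat_adjoint U"
    using hermitian_diagonalization[OF A] by blast
  note U' = mat_adjoint_carrier[OF U]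
  have D: "diag_of_list es \<in> carrier_mat n n" using es by simp
  have UU': "U * mat_adjoint U = 1\<^sub>m n" using mat_mult_left_right_inverse[OF U' U UU] .
  have UD: "(U * diag_of_list es) $$ (i, k) = U $$ (i, k) * es ! k" if "i < n" "k < n" for i k
  proof -
    have "(U * diag_of_list es) $$ (i, k) = (\<Sum>l<n. U $$ (i, l) * (if l = k then es ! l else 0))"
      using U es that by (auto simp: scalar_prod_def atLeast0LessThan diag_of_list_def)
    also have "\<dots> = (\<Sum>l<n. if l = k then U $$ (i, k) * es ! k else 0)" by (intro sum.cong) auto
    also have "\<dots> = U $$ (i, k) * es ! k" using that by simp
    finally show ?thesis .
  qed
  have Aij: "A $$ (i, j) = (\<Sum>k<n. U $$ (i, k) * es ! k * cnj (U $$ (j, k)))" if "i < n" "j < n" for i j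
  proof -
    have "A $$ (i, j) = (\<Sum>k<n. (U * diag_of_list es) $$ (i, k) * mat_adjoint U $$ (k, j))"
      unfolding Aeq by (rule mat_mult_index_sum[OF mult_carrier_mat[OF U D] U' that])
    also have "\<dots> = (\<Sum>k<n. U $$ (i, k) * es ! k * cnj (U $$ (j, k)))"
      using that by (intro sum.cong refl) (simp add: UD mat_adjoint_index[OF U] del: index_mult_mat(1))
    finally show ?thesis .
  qed
  have ortho: "(\<Sum>j<n. U $$ (j, k) * cnj (U $$ (j, i))) = (if i = k then 1 else 0)" if "i < n" "k < n" for i k
  proof -
    have "(mat_adjoint U * U) $$ (i, k) = (\<Sum>j<n. mat_adjoint U $$ (i, j) * U $$ (j, k))"
      using U that by (simp add: scalar_prod_def atLeast0LessThan)
    also have "\<dots> = (\<Sum>j<n. U $$ (j, k) * cnj (U $$ (j, i)))"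
      using that by (intro sum.cong refl) (simp add: mat_adjoint_index[OF U] mult.commute)
    finally show ?thesis using that by (simp add: UU)
  qed
  have form: "mat_form A n c = (\<Sum>k<n. es ! k * of_real ((cmod (\<Sum>j<n. U $$ (j, k) * c j))\<^sup>2))" for c
  proof -
    have "mat_form A n c =
      (\<Sum>i<n. \<Sum>j<n. \<Sum>k<n. es ! k * ((U $$ (i, k) * c i) * cnj (U $$ (j, k) * c j)))"
      unfolding mat_form_def by (intro sum.cong refl) (simp add: Aij sum_distrib_left sum_distrib_right mult_ac)
    also have "\<dots> = (\<Sum>i<n. \<Sum>k<n. \<Sum>j<n. es ! k * ((U $$ (i, k) * c i) * cnj (U $$ (j, k) * c j)))"
      by (rule sum.cong[OF refl], rule sum.swap)
    also have "\<dots> = (\<Sum>k<n. \<Sum>i<n. \<Sum>j<n. es ! k * ((U $$ (i, k) * c i) * cnj (U $$ (j, k) * c j)))"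
      by (rule sum.swap)
    also have "\<dots> = (\<Sum>k<n. es ! k * of_real ((cmod (\<Sum>j<n. U $$ (j, k) * c j))\<^sup>2))"
      unfolding complex_norm_square cnj_sum sum_product by (simp add: sum_distrib_left)
    finally show ?thesis .
  qed
  have real: "es ! k = of_real (Re (es ! k))" if "k < n" for k
  proof -
    \<comment> \<open>For this vector all terms of the diagonalized form but the \<open>k\<close>-th
      vanish, so \<open>es ! k\<close> is a value of the form. Such a value equals its own conjugate
      because \<open>A\<close> is Hermitian.\<close>
    define c where "c j = cnj (U $$ (j, k))" for j
    have "es ! k = mat_form A n c"
    proof -
      have "mat_form A n c = (\<Sum>i<n. if i = k then es ! k else 0)"
        unfolding form c_def using that by (intro sum.cong refl) (auto simp: ortho)
      then show ?thesis using that by simp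
    qed
    moreover have "cnj (mat_form A n c) = mat_form A n c"
      unfolding mat_form_def cnj_sum
      by (subst sum.swap, intro sum.cong refl) (simp add: herm[symmetric] mult_ac)
    ultimately show ?thesis by (simp add: complex_eq_iff)
  qed
  have "char_poly A = char_poly (diag_of_list es)"
    by (rule char_poly_similar, rule similar_matI[of _ _ U "mat_adjoint U" n])
      (use A U U' D UU UU' Aeq in auto)
  then have cp: "char_poly A = (\<Prod>e\<leftarrow>es. [:- e, 1:])" by (simp add: char_poly_diag_of_list)
  define S where "S = {a::real. a < 0 \<and> poly (char_poly A) (complex_of_real a) = 0}"
  have S: "S = {a. a < 0 \<and> complex_of_real a \<in> set es}"
  proof -
    have "(\<Prod>e\<leftarrow>es. [:- e, 1:]) \<noteq> 0" by (auto simp: prod_list_zero_iff)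
    then show ?thesis
      unfolding S_def cp by (auto simp: order_root order_prod_list_linear filter_empty_conv)
  qed
  have "finite S"
    by (rule finite_subset[OF _ finite_vimageI[of "set es" complex_of_real]]) (auto simp: S inj_of_real)
  have "sq_minus A = (\<Sum>a\<in>S. card {k. k < n \<and> es ! k = complex_of_real a})"
    unfolding sq_minus_def S_def[symmetric] unfolding cp order_prod_list_linear length_filter_conv_card es
    by (intro sum.cong arg_cong[of _ _ card]) auto
  also have "\<dots> = card (\<Union>a\<in>S. {k. k < n \<and> es ! k = complex_of_real a})"
    using \<open>finite S\<close> by (subst card_UN_disjoint) auto
  also have "(\<Union>a\<in>S. {k. k < n \<and> es ! k = complex_of_real a}) = {k. k < n \<and> Re (es ! k) < 0}"
    (is "?L = ?R")
  proof
    show "?L \<subseteq> ?R" by (auto simp: S)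
    show "?R \<subseteq> ?L"
    proof
      fix k assume "k \<in> ?R"
      then have "k < n" "Re (es ! k) < 0" by auto
      then show "k \<in> ?L"
        using real[of k] nth_mem[of k es] es by (auto simp: S intro!: exI[of _ "Re (es ! k)"])
    qed
  qed
  finally have sq: "sq_minus A = card {k. k < n \<and> Re (es ! k) < 0}" .
  show ?thesis
  proof (rule exI[of _ "\<lambda>k j. U $$ (j, k)"], rule exI[of _ "\<lambda>j i. cnj (U $$ (j, i))"],
      rule exI[of _ "\<lambda>k. Re (es ! k)"], intro conjI allI impI)
    show "mat_form A n c = of_real (\<Sum>k<n. Re (es ! k) * (cmod (\<Sum>j<n. U $$ (j, k) * c j))\<^sup>2)" for c
      unfolding form of_real_sum of_real_mult
      by (intro sum.cong refl arg_cong2[of _ _ _ _ "(*)"]) (auto intro: real)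
    show "(\<Sum>j<n. U $$ (j, k) * (\<Sum>i<n. cnj (U $$ (j, i)) * y i)) = y k" if "k < n" for y k
    proof -
      have "(\<Sum>j<n. U $$ (j, k) * (\<Sum>i<n. cnj (U $$ (j, i)) * y i)) =
            (\<Sum>i<n. (\<Sum>j<n. U $$ (j, k) * cnj (U $$ (j, i))) * y i)"
        unfolding sum_distrib_left sum_distrib_right by (subst sum.swap) (simp add: mult_ac)
      also have "\<dots> = (\<Sum>i<n. if i = k then y k else 0)"
        using that by (intro sum.cong refl) (simp add: ortho)
      finally show ?thesis using that by simp
    qed
  qed (fact sq)
qed

text \<open>With fewer negative coordinates than parameters, some nonzero \<open>x\<close> would
  make all negative coordinates vanish, and the form would be nonnegative there.\<close>

lemma sq_minus_ge:
  fixes A :: "complex mat" and g :: "nat \<Rightarrow> 'k \<Rightarrow> complex"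
  assumes A: "A \<in> carrier_mat n n" and herm: "\<And>i j. i < n \<Longrightarrow> j < n \<Longrightarrow> A $$ (i, j) = cnj (A $$ (j, i))"
    and K: "finite K"
    and neg: "\<And>x. \<exists>k\<in>K. x k \<noteq> 0 \<Longrightarrow> Re (mat_form A n (\<lambda>i. \<Sum>k\<in>K. g i k * x k)) < 0"
  shows "card K \<le> sq_minus A"
proof (rule ccontr)
  assume less: "\<not> card K \<le> sq_minus A"
  obtain u v r where form: "\<forall>c. mat_form A n c = of_real (\<Sum>k<n. r k * (cmod (\<Sum>j<n. u k j * c j))\<^sup>2)"
    and sq: "sq_minus A = card {k. k < n \<and> r k < 0}"
    using hermitian_inertia[OF A herm] by blast
  have fin: "finite {k. k < n \<and> r k < 0}" by simp
  have "card {k. k < n \<and> r k < 0} < card K" using less sq by simp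
  from homogeneous_system_nontrivial[OF fin K this, of "\<lambda>i k. \<Sum>j<n. u i j * g j k"]
  obtain x where x: "\<exists>k\<in>K. x k \<noteq> 0"
    "\<forall>i\<in>{k. k < n \<and> r k < 0}. (\<Sum>k\<in>K. (\<Sum>j<n. u i j * g j k) * x k) = 0" by blast
  have eq: "(\<Sum>j<n. u i j * (\<Sum>k\<in>K. g j k * x k)) = (\<Sum>k\<in>K. (\<Sum>j<n. u i j * g j k) * x k)" for i
    unfolding sum_distrib_left sum_distrib_right by (subst sum.swap) (simp add: mult_ac)
  have "0 \<le> (\<Sum>i<n. r i * (cmod (\<Sum>j<n. u i j * (\<Sum>k\<in>K. g j k * x k)))\<^sup>2)"
  proof (rule sum_nonneg)
    fix i assume "i \<in> {..<n}"
    then show "0 \<le> r i * (cmod (\<Sum>j<n. u i j * (\<Sum>k\<in>K. g j k * x k)))\<^sup>2"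
      using x(2) by (cases "r i < 0") (auto simp: eq)
  qed
  then show False using neg[OF x(1)] unfolding form[rule_format] by simp
qed

text \<open>With more negative coordinates than conditions, some nonzero vector supported on the
  negative coordinates would satisfy all conditions, and the form would be negative there.\<close>

lemma sq_minus_le:
  fixes A :: "complex mat" and g :: "'k \<Rightarrow> nat \<Rightarrow> complex"
  assumes A: "A \<in> carrier_mat n n" and herm: "\<And>i j. i < n \<Longrightarrow> j < n \<Longrightarrow> A $$ (i, j) = cnj (A $$ (j, i))"
    and K: "finite K"
    and pos: "\<And>c. \<forall>k\<in>K. (\<Sum>j<n. g k j * c j) = 0 \<Longrightarrow> 0 \<le> Re (mat_form A n c)"
  shows "sq_minus A \<le> card K"
proof (rule ccontr)
  assume less: "\<not> sq_minus A \<le> card K"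
  obtain u v r where form: "\<forall>c. mat_form A n c = of_real (\<Sum>k<n. r k * (cmod (\<Sum>j<n. u k j * c j))\<^sup>2)"
    and inv: "\<forall>y. \<forall>k<n. (\<Sum>j<n. u k j * (\<Sum>i<n. v j i * y i)) = y k"
    and sq: "sq_minus A = card {k. k < n \<and> r k < 0}"
    using hermitian_inertia[OF A herm] by blast
  define J where "J = {k. k < n \<and> r k < 0}"
  have J: "finite J" "J \<subseteq> {..<n}" by (auto simp: J_def)
  have "card K < card J" using less sq by (simp add: J_def)
  from homogeneous_system_nontrivial[OF K J(1) this, of "\<lambda>k i. \<Sum>j<n. g k j * v j i"]
  obtain x where x: "\<exists>i\<in>J. x i \<noteq> 0"
    "\<forall>k\<in>K. (\<Sum>i\<in>J. (\<Sum>j<n. g k j * v j i) * x i) = 0" by blast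
  define y where "y i = (if i \<in> J then x i else 0)" for i
  define c where "c j = (\<Sum>i<n. v j i * y i)" for j
  have uc: "(\<Sum>j<n. u k j * c j) = y k" if "k < n" for k
    unfolding c_def using inv[rule_format, OF that] .
  have "(\<Sum>j<n. g k j * c j) = 0" if "k \<in> K" for k
  proof -
    have "(\<Sum>j<n. g k j * c j) = (\<Sum>i<n. (\<Sum>j<n. g k j * v j i) * y i)"
      unfolding c_def sum_distrib_left sum_distrib_right by (subst sum.swap) (simp add: mult_ac)
    also have "\<dots> = (\<Sum>i\<in>J. (\<Sum>j<n. g k j * v j i) * x i)"
      using J(2) by (intro sum.mono_neutral_cong_right) (auto simp: y_def)
    finally show ?thesis using x(2) that by simp
  qed
  then have "0 \<le> Re (mat_form A n c)" using pos by blast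
  also have "Re (mat_form A n c) = (\<Sum>k<n. r k * (cmod (y k))\<^sup>2)"
    unfolding form[rule_format] by (simp add: uc)
  also have "\<dots> = (\<Sum>k\<in>J. r k * (cmod (x k))\<^sup>2)"
    using J(2) by (intro sum.mono_neutral_cong_right) (auto simp: y_def)
  also have "\<dots> < 0"
  proof -
    obtain i where i: "i \<in> J" "x i \<noteq> 0" using x(1) by blast
    have "(\<Sum>k\<in>J. r k * (cmod (x k))\<^sup>2) = r i * (cmod (x i))\<^sup>2 + (\<Sum>k\<in>J - {i}. r k * (cmod (x k))\<^sup>2)"
      using i J by (simp add: sum.remove)
    moreover have "r i * (cmod (x i))\<^sup>2 < 0" using i by (auto simp: J_def mult_neg_pos)
    moreover have "(\<Sum>k\<in>J - {i}. r k * (cmod (x k))\<^sup>2) \<le> 0"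
      by (intro sum_nonpos) (auto simp: J_def mult_nonpos_nonneg)
    ultimately show ?thesis by linarith
  qed
  finally show False by simp
qed

section \<open>The upper bound\<close>

text \<open>Cauchy's formula as the reproducing property of the Szego kernel: on the unit circle
  \<open>cnj u = 1 / u\<close>, so the conjugated kernel times arc length is the Cauchy kernel. The
  parameter runs over an interval of length 1, so the measure is normalized.\<close>

lemma has_integral_szego:
  assumes h: "h holomorphic_on cball 0 1" and w: "norm w < 1"
  shows "((\<lambda>x. h (circlepath 0 1 x) * cnj (1 / (1 - cnj w * circlepath 0 1 x))) has_integral h w) {0..1}"
proof -
  define \<gamma> where "\<gamma> = circlepath 0 1"
  have \<gamma>: "\<gamma> x * cnj (\<gamma> x) = 1" for x
    by (simp add: \<gamma>_def circlepath exp_cnj mult_exp_exp)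
  then have \<gamma>0: "\<gamma> x \<noteq> 0" for x by (metis mult_zero_left zero_neq_one)
  have "((\<lambda>u. h u / (u - w)) has_contour_integral (2 * of_real pi * \<i> * h w)) (circlepath 0 1)"
    by (rule Cauchy_integral_circlepath_simple[OF h]) (use w in simp)
  then have "((\<lambda>x. h (\<gamma> x) / (\<gamma> x - w) * vector_derivative \<gamma> (at x within {0..1}))
      has_integral (2 * of_real pi * \<i> * h w)) {0..1}"
    unfolding has_contour_integral_def \<gamma>_def .
  then have "((\<lambda>x. (2 * of_real pi * \<i>) * (h (\<gamma> x) * cnj (1 / (1 - cnj w * \<gamma> x))))
      has_integral (2 * of_real pi * \<i> * h w)) {0..1}"
  proof (rule has_integral_eq[rotated])
    fix x :: real assume x: "x \<in> {0..1}"
    have "vector_derivative \<gamma> (at x within {0..1}) = 2 * of_real pi * \<i> * \<gamma> x"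
      using x unfolding \<gamma>_def by (subst vector_derivative_circlepath01) (auto simp: circlepath)
    moreover have "1 - w * cnj (\<gamma> x) = (\<gamma> x - w) / \<gamma> x"
      using \<gamma>[of x] \<gamma>0[of x] by (simp add: field_simps)
    then have "cnj (1 / (1 - cnj w * \<gamma> x)) = \<gamma> x / (\<gamma> x - w)" by simp
    ultimately show "h (\<gamma> x) / (\<gamma> x - w) * vector_derivative \<gamma> (at x within {0..1}) =
      2 * of_real pi * \<i> * (h (\<gamma> x) * cnj (1 / (1 - cnj w * \<gamma> x)))"
      by (simp only:) (simp add: mult_ac)
  qed
  then have "((\<lambda>x. inverse (2 * of_real pi * \<i>) * ((2 * of_real pi * \<i>) * (h (\<gamma> x) * cnj (1 / (1 - cnj w * \<gamma> x)))))
      has_integral (inverse (2 * of_real pi * \<i>) * (2 * of_real pi * \<i> * h w))) {0..1}"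
    by (rule has_integral_mult_right)
  then show ?thesis unfolding \<gamma>_def by (simp add: field_simps)
qed

text \<open>The form is the integral of a nonnegative function. Let \<open>u\<close> and
  \<open>v\<close> be the combinations of the kernels \<open>k i\<close> with weights
  \<open>cnj (e i)\<close> and \<open>cnj (e i) * cnj (S (z i))\<close>, and \<open>s\<close> the
  boundary value of \<open>S\<close>. The integrand is \<open>(norm (cnj s * u - v))\<^sup>2 + (1 -
  (norm s)\<^sup>2) * (norm u)\<^sup>2\<close>.\<close>

lemma schur_pick_nonneg_cball:
  fixes z e :: "'i \<Rightarrow> complex"
  assumes S: "S holomorphic_on cball 0 1" and bd: "\<And>u. norm u \<le> 1 \<Longrightarrow> norm (S u) \<le> 1"
    and z: "\<And>i. i \<in> I \<Longrightarrow> norm (z i) < 1"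
  shows "0 \<le> Re (\<Sum>i\<in>I. \<Sum>j\<in>I. (1 - S (z i) * cnj (S (z j))) / (1 - z i * cnj (z j)) * e i * cnj (e j))"
proof (cases "finite I")
  case True
  define \<gamma> where "\<gamma> = circlepath 0 1"
  define k where "k i u = 1 / (1 - cnj (z i) * u)" for i u
  have n\<gamma>: "norm (\<gamma> x) = 1" for x by (simp add: \<gamma>_def circlepath)
  have ne: "1 - cnj (z i) * u \<noteq> 0" if "i \<in> I" "norm u \<le> 1" for i u
  proof -
    have "norm (cnj (z i) * u) < 1"
      using z[OF that(1)] that(2) mult_left_le[of "norm u" "norm (z i)"] by (simp add: norm_mult)
    then show ?thesis by auto
  qed
  have hk: "k i holomorphic_on cball 0 1" if "i \<in> I" for i
    unfolding k_def using ne[OF that] by (intro holomorphic_intros) auto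
  have hSk: "(\<lambda>u. S u * k i u) holomorphic_on cball 0 1" if "i \<in> I" for i
    by (intro holomorphic_intros S hk that)
  have ksym: "cnj (k i (z j)) = k j (z i)" for i j by (simp add: k_def mult.commute)
  have I1: "((\<lambda>x. k i (\<gamma> x) * cnj (k j (\<gamma> x))) has_integral k i (z j)) {0..1}" if "i \<in> I" "j \<in> I" for i j
    using has_integral_szego[OF hk[OF that(1)] z[OF that(2)]] by (simp add: \<gamma>_def k_def)
  have I2: "((\<lambda>x. S (\<gamma> x) * k i (\<gamma> x) * cnj (k j (\<gamma> x))) has_integral S (z j) * k i (z j)) {0..1}"
    if "i \<in> I" "j \<in> I" for i j
    using has_integral_szego[OF hSk[OF that(1)] z[OF that(2)]] by (simp add: \<gamma>_def k_def)
  have I3: "((\<lambda>x. cnj (S (\<gamma> x)) * k i (\<gamma> x) * cnj (k j (\<gamma> x))) has_integral cnj (S (z i)) * k i (z j)) {0..1}"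
    if "i \<in> I" "j \<in> I" for i j
  proof -
    have "((\<lambda>x. cnj (S (\<gamma> x) * k j (\<gamma> x) * cnj (k i (\<gamma> x)))) has_integral cnj (S (z i) * k j (z i))) {0..1}"
      using has_integral_linear[OF I2[OF that(2,1)] bounded_linear_cnj] by (simp add: o_def)
    then show ?thesis by (simp add: ksym mult_ac)
  qed
  define F where "F x = (\<Sum>i\<in>I. \<Sum>j\<in>I. cnj (e i) * e j * (k i (\<gamma> x) * cnj (k j (\<gamma> x))
      - S (z j) * (cnj (S (\<gamma> x)) * k i (\<gamma> x) * cnj (k j (\<gamma> x)))
      - cnj (S (z i)) * (S (\<gamma> x) * k i (\<gamma> x) * cnj (k j (\<gamma> x)))
      + cnj (S (z i)) * S (z j) * (k i (\<gamma> x) * cnj (k j (\<gamma> x)))))" for x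
  \<comment> \<open>By the reproducing property the last three terms of a summand agree up to sign.
    One survives with a minus sign, which leaves a Pick entry.\<close>
  define G where "G = (\<Sum>i\<in>I. \<Sum>j\<in>I. cnj (e i) * e j * (k i (z j)
      - S (z j) * (cnj (S (z i)) * k i (z j)) - cnj (S (z i)) * (S (z j) * k i (z j))
      + cnj (S (z i)) * S (z j) * k i (z j)))"
  have "(F has_integral G) {0..1}"
    unfolding F_def G_def using True
    by (intro has_integral_sum has_integral_mult_right has_integral_add has_integral_diff I1 I2 I3) auto
  then have "((\<lambda>x. Re (F x)) has_integral Re G) {0..1}"
    using has_integral_linear[OF _ bounded_linear_Re, of F G] by (simp add: o_def)
  moreover have "0 \<le> Re (F x)" for x
  proof -
    define u where "u = (\<Sum>i\<in>I. cnj (e i) * k i (\<gamma> x))"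
    define v where "v = (\<Sum>i\<in>I. cnj (e i) * cnj (S (z i)) * k i (\<gamma> x))"
    define s where "s = S (\<gamma> x)"
    have ns: "norm s \<le> 1" unfolding s_def by (rule bd) (simp add: n\<gamma>)
    have "F x = u * cnj u - cnj s * u * cnj v - s * v * cnj u + v * cnj v"
      unfolding F_def u_def v_def s_def[symmetric] cnj_sum
      by (simp add: sum_product sum_distrib_left sum_distrib_right sum.distrib sum_subtractf algebra_simps)
        (rule sum.swap)
    also have "\<dots> = (cnj s * u - v) * cnj (cnj s * u - v) + (1 - s * cnj s) * (u * cnj u)"
      by (simp add: algebra_simps)
    also have "\<dots> = of_real ((norm (cnj s * u - v))\<^sup>2 + (1 - (norm s)\<^sup>2) * (norm u)\<^sup>2)"
      by (simp only: complex_norm_square of_real_add of_real_mult of_real_diff of_real_1)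
    finally show ?thesis using ns by (simp add: power_le_one)
  qed
  ultimately have "0 \<le> Re G" by (rule has_integral_nonneg)
  also have "G = (\<Sum>i\<in>I. \<Sum>j\<in>I. (1 - S (z i) * cnj (S (z j))) / (1 - z i * cnj (z j)) * e i * cnj (e j))"
    unfolding G_def by (subst sum.swap, intro sum.cong refl) (simp add: k_def divide_inverse algebra_simps)
  finally show ?thesis .
qed simp

text \<open>The dilations \<open>S (r u)\<close> with \<open>r < 1\<close> are holomorphic on the
  closed disk, where the previous lemma applies. Only the values of \<open>S\<close> are dilated
  while the denominators stay fixed, so letting \<open>r\<close> tend to 1 is an entrywise
  limit.\<close>

lemma schur_pick_nonneg:
  fixes z e :: "'i \<Rightarrow> complex"
  assumes S: "schur_function S" and z: "\<And>i. i \<in> I \<Longrightarrow> norm (z i) < 1"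
  shows "0 \<le> Re (\<Sum>i\<in>I. \<Sum>j\<in>I. (1 - S (z i) * cnj (S (z j))) / (1 - z i * cnj (z j)) * e i * cnj (e j))"
proof -
  define r where "r n = 1 - inverse (real (Suc (Suc n)))" for n
  have r: "0 \<le> r n" "r n < 1" for n by (auto simp: r_def field_simps)
  have "r \<longlonglongrightarrow> 1 - 0"
    unfolding r_def by (intro tendsto_intros LIMSEQ_Suc[OF LIMSEQ_inverse_real_of_nat])
  then have rlim: "r \<longlonglongrightarrow> 1" by simp
  have holo: "S holomorphic_on ball 0 1" and bd: "\<And>u. norm u < 1 \<Longrightarrow> norm (S u) \<le> 1"
    using S by (auto simp: schur_function_def)
  have ru: "norm (of_real (r n) * u) < 1" if "norm u \<le> 1" for n and u :: complex
    using r[of n] that mult_left_le[of "norm u" "r n"] by (simp add: norm_mult)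
  have lim: "(\<lambda>n. S (of_real (r n) * z i)) \<longlonglongrightarrow> S (z i)" if "i \<in> I" for i
  proof (rule isCont_tendsto_compose[of "z i" S])
    show "isCont S (z i)"
      using holo z[OF that] by (auto intro!: continuous_on_interior[of "ball 0 1"] holomorphic_on_imp_continuous_on)
    have "(\<lambda>n. of_real (r n) * z i) \<longlonglongrightarrow> of_real 1 * z i"
      by (intro tendsto_intros rlim)
    then show "(\<lambda>n. of_real (r n) * z i) \<longlonglongrightarrow> z i" by simp
  qed
  have "(\<lambda>n. Re (\<Sum>i\<in>I. \<Sum>j\<in>I. (1 - S (of_real (r n) * z i) * cnj (S (of_real (r n) * z j))) /
            (1 - z i * cnj (z j)) * e i * cnj (e j))) \<longlonglongrightarrow>
        Re (\<Sum>i\<in>I. \<Sum>j\<in>I. (1 - S (z i) * cnj (S (z j))) / (1 - z i * cnj (z j)) * e i * cnj (e j))"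
    unfolding divide_inverse by (intro tendsto_intros lim) auto
  then show ?thesis
  proof (rule LIMSEQ_le_const, intro exI allI impI)
    fix n
    show "0 \<le> Re (\<Sum>i\<in>I. \<Sum>j\<in>I. (1 - S (of_real (r n) * z i) * cnj (S (of_real (r n) * z j))) /
            (1 - z i * cnj (z j)) * e i * cnj (e j))"
    proof (rule schur_pick_nonneg_cball[of "\<lambda>u. S (of_real (r n) * u)"])
      have "S \<circ> (\<lambda>u. of_real (r n) * u) holomorphic_on cball 0 1"
        by (rule holomorphic_on_compose_gen[OF _ holo]) (use ru in \<open>auto intro!: holomorphic_intros\<close>)
      then show "(\<lambda>u. S (of_real (r n) * u)) holomorphic_on cball 0 1" by (simp add: o_def)
    qed (use bd ru z in auto)
  qed
qed

text \<open>The functions \<open>\<phi> k\<close> are the Takenaka--Malmquist functions of the zeros \<open>as\<close>.\<close>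
lemma blaschke_kernel_finite_rank:
  fixes as :: "complex list"
  defines "b \<equiv> \<lambda>as z. \<Prod>a\<leftarrow>as. (z - a) / (1 - cnj a * z)"
  assumes "\<forall>a\<in>set as. norm a < 1"
  shows "\<exists>\<phi>. \<forall>z w. norm z < 1 \<longrightarrow> norm w < 1 \<longrightarrow>
    (1 - b as z * cnj (b as w)) / (1 - z * cnj w) = (\<Sum>k<length as. \<phi> k z * cnj (\<phi> k w))"
  using assms(2)
proof (induction as)
  case Nil
  then show ?case by (simp add: b_def)
next
  case (Cons a as)
  then obtain \<phi> where \<phi>: "\<And>z w. norm z < 1 \<Longrightarrow> norm w < 1 \<Longrightarrow>
    (1 - b as z * cnj (b as w)) / (1 - z * cnj w) = (\<Sum>k<length as. \<phi> k z * cnj (\<phi> k w))" by auto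
  define \<beta> where "\<beta> z = (z - a) / (1 - cnj a * z)" for z
  have a: "norm a < 1" using Cons.prems by simp
  \<comment> \<open>Index 0 is the normalized Szego kernel at \<open>a\<close>; the earlier
    functions move up by one index and are multiplied by the new factor \<beta>.\<close>
  define \<psi> where "\<psi> k z = (case k of 0 \<Rightarrow> of_real (sqrt (1 - (norm a)\<^sup>2)) / (1 - cnj a * z) | Suc k \<Rightarrow> \<beta> z * \<phi> k z)" for k z
  have ne: "1 - cnj u * v \<noteq> 0" if "norm u < 1" "norm v < 1" for u v
  proof -
    have "norm (cnj u * v) < 1" using that mult_strict_mono'[of "norm u" 1 "norm v" 1] by (simp add: norm_mult)
    then show ?thesis by auto
  qed
  have "(1 - b (a # as) z * cnj (b (a # as) w)) / (1 - z * cnj w) =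
        (\<Sum>k<length (a # as). \<psi> k z * cnj (\<psi> k w))" if zw: "norm z < 1" "norm w < 1" for z w
  proof -
    have nz: "1 - z * cnj w \<noteq> 0" "1 - cnj a * z \<noteq> 0" "1 - a * cnj w \<noteq> 0"
      using ne[OF zw(2,1)] ne[OF a zw(1)] ne[OF zw(2) a] by (auto simp: mult.commute)
    have "(norm a)\<^sup>2 \<le> 1" using a by (simp add: power_le_one)
    then have sq: "of_real (sqrt (1 - (norm a)\<^sup>2)) * of_real (sqrt (1 - (norm a)\<^sup>2)) = 1 - a * cnj a"
      by (simp flip: of_real_mult complex_norm_square)
    have "(1 - \<beta> z * cnj (\<beta> w)) / (1 - z * cnj w) = (1 - a * cnj a) / ((1 - cnj a * z) * (1 - a * cnj w))"
      using nz by (simp add: \<beta>_def divide_simps) (simp add: algebra_simps)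
    also have "\<dots> = \<psi> 0 z * cnj (\<psi> 0 w)" by (simp add: \<psi>_def sq)
    finally have 1: "(1 - \<beta> z * cnj (\<beta> w)) / (1 - z * cnj w) = \<psi> 0 z * cnj (\<psi> 0 w)" .
    have bc: "b (a # as) u = \<beta> u * b as u" for u by (simp add: b_def \<beta>_def)
    \<comment> \<open>Adding and subtracting \<open>\<beta> z * cnj (\<beta> w)\<close> in the
      numerator separates the new factor from the old ones.\<close>
    have "(1 - b (a # as) z * cnj (b (a # as) w)) / (1 - z * cnj w) =
       (1 - \<beta> z * cnj (\<beta> w)) / (1 - z * cnj w) +
       \<beta> z * cnj (\<beta> w) * ((1 - b as z * cnj (b as w)) / (1 - z * cnj w))"
      unfolding bc by (simp add: add_divide_distrib[symmetric] algebra_simps)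
    also have "\<dots> = (\<Sum>k<length (a # as). \<psi> k z * cnj (\<psi> k w))"
      unfolding 1 \<phi>[OF zw] by (simp add: sum.lessThan_Suc_shift sum_distrib_left \<psi>_def mult_ac del: sum.lessThan_Suc)
    finally show ?thesis .
  qed
  then show ?case by blast
qed

section \<open>Pick matrices and the bound \<open>q + card Z\<close>\<close>

lemma pick_matrix_carrier: "pick_matrix f zs \<in> carrier_mat (length zs) (length zs)"
  by (simp add: pick_matrix_def)

lemma pick_matrix_hermitian:
  "i < length zs \<Longrightarrow> j < length zs \<Longrightarrow> pick_matrix f zs $$ (i, j) = cnj (pick_matrix f zs $$ (j, i))"
  by (simp add: pick_matrix_def mult.commute)

lemma mat_form_pick_matrix:
  "mat_form (pick_matrix f zs) (length zs) c =
    (\<Sum>i<length zs. \<Sum>j<length zs. (1 - f (zs!i) * cnj (f (zs!j))) / (1 - zs!i * cnj (zs!j)) * c i * cnj (c j))"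
  by (simp add: mat_form_def pick_matrix_def)

theorem sq_minus_pick_matrix_le:
  assumes std: "standard_function f S B q Z W" and zs: "distinct zs" "set zs \<subseteq> ball 0 1 - W"
  shows "sq_minus (pick_matrix f zs) \<le> q + card Z"
proof -
  have Z: "finite Z" and S: "schur_function S" and B: "blaschke_product B q"
    and ZB: "zeroset B \<subseteq> W \<union> Z" and f: "\<And>z. z \<in> ball 0 1 - (W \<union> Z) \<Longrightarrow> f z = S z / B z"
    using std by (auto simp: standard_function_def)
  obtain c0 as where c0: "norm c0 = 1" and as: "length as = q" "\<forall>a\<in>set as. norm a < 1"
    and Beq: "\<And>z. norm z \<le> 1 \<Longrightarrow> B z = c0 * (\<Prod>a\<leftarrow>as. (z - a) / (1 - cnj a * z))"
    using B unfolding blaschke_product_def by blast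
  obtain \<phi> where \<phi>: "\<And>z w. norm z < 1 \<Longrightarrow> norm w < 1 \<Longrightarrow>
    (1 - (\<Prod>a\<leftarrow>as. (z - a) / (1 - cnj a * z)) * cnj (\<Prod>a\<leftarrow>as. (w - a) / (1 - cnj a * w))) / (1 - z * cnj w)
      = (\<Sum>k<q. \<phi> k z * cnj (\<phi> k w))"
    using blaschke_kernel_finite_rank[OF as(2)] as(1) by blast
  have KB: "(1 - B z * cnj (B w)) / (1 - z * cnj w) = (\<Sum>k<q. \<phi> k z * cnj (\<phi> k w))"
    if "norm z < 1" "norm w < 1" for z w
  proof -
    have "c0 * cnj c0 = 1" using c0 by (simp flip: complex_norm_square)
    then have "B z * cnj (B w) = (\<Prod>a\<leftarrow>as. (z - a) / (1 - cnj a * z)) * cnj (\<Prod>a\<leftarrow>as. (w - a) / (1 - cnj a * w))"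
      using that by (simp add: Beq mult_ac)
    then show ?thesis using \<phi>[OF that] by simp
  qed
  define n where "n = length zs"
  have zsn: "norm (zs ! i) < 1" "zs ! i \<notin> W" if "i < n" for i
    using zs(2) nth_mem[of i zs] that by (auto simp: n_def subset_iff)
  have B0: "B (zs ! i) \<noteq> 0" if "i < n" "zs ! i \<notin> Z" for i
    using ZB zsn[OF that(1)] that(2) by (auto simp: zeroset_def)
  \<comment> \<open>The index set of the linear conditions: the left summand for the
    \<open>q\<close> functions spanning the kernel of \<open>B\<close>, the right one for the
    jumps.\<close>
  define K where "K = (Inl ` {..<q} \<union> Inr ` Z :: (nat + complex) set)"
  define g where "g k j = (case k of
      Inl k \<Rightarrow> if zs ! j \<in> Z then 0 else \<phi> k (zs ! j) / B (zs ! j)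
    | Inr z \<Rightarrow> if zs ! j = z then 1 else 0)" for k j
  have finK: "finite K" using Z by (simp add: K_def)
  have cardK: "card K = q + card Z"
    unfolding K_def using Z by (subst card_Un_disjoint) (auto simp: card_image)
  have "sq_minus (pick_matrix f zs) \<le> card K"
  proof (rule sq_minus_le[OF pick_matrix_carrier pick_matrix_hermitian finK, where g = g])
    fix c :: "nat \<Rightarrow> complex"
    assume "\<forall>k\<in>K. (\<Sum>j<length zs. g k j * c j) = 0"
    then have c1: "\<And>k. k < q \<Longrightarrow> (\<Sum>j<n. g (Inl k) j * c j) = 0"
      and c2: "\<And>z. z \<in> Z \<Longrightarrow> (\<Sum>j<n. g (Inr z) j * c j) = 0" by (auto simp: K_def n_def)
    have cZ: "c i = 0" if "i < n" "zs ! i \<in> Z" for i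
    proof -
      have "(\<Sum>j<n. g (Inr (zs ! i)) j * c j) = (\<Sum>j<n. if j = i then c i else 0)"
        using that zs(1) by (intro sum.cong refl) (auto simp: g_def n_def nth_eq_iff_index_eq)
      then show ?thesis using c2[OF that(2)] that by simp
    qed
    \<comment> \<open>Off the jumps \<open>B\<close> does not vanish at the nodes, because its zeros
      lie in \<open>W \<union> Z\<close> and the nodes avoid \<open>W\<close>. The value 0 at the
      jumps agrees with \<open>cZ\<close>.\<close>
    define e where "e i = (if zs ! i \<in> Z then 0 else c i / B (zs ! i))" for i
    have sum0: "(\<Sum>j<n. e j * \<phi> k (zs ! j)) = 0" if "k < q" for k
    proof -
      have "(\<Sum>j<n. e j * \<phi> k (zs ! j)) = (\<Sum>j<n. g (Inl k) j * c j)"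
        by (intro sum.cong refl) (auto simp: g_def e_def)
      then show ?thesis using c1[OF that] by simp
    qed
    have entry: "(1 - f (zs!i) * cnj (f (zs!j))) / (1 - zs!i * cnj (zs!j)) * c i * cnj (c j) =
      (1 - S (zs!i) * cnj (S (zs!j))) / (1 - zs!i * cnj (zs!j)) * e i * cnj (e j) -
      (\<Sum>k<q. (e i * \<phi> k (zs!i)) * cnj (e j * \<phi> k (zs!j)))" if ij: "i < n" "j < n" for i j
    proof (cases "zs ! i \<in> Z \<or> zs ! j \<in> Z")
      case True
      then show ?thesis using cZ ij by (auto simp: e_def)
    next
      case False
      then have nz: "B (zs!i) \<noteq> 0" "B (zs!j) \<noteq> 0" using B0 ij by auto
      have fi: "f (zs!i) = S (zs!i) / B (zs!i)" "f (zs!j) = S (zs!j) / B (zs!j)"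
        using False zsn ij by (auto intro!: f)
      have ei: "c i = e i * B (zs!i)" "c j = e j * B (zs!j)" using False nz by (auto simp: e_def)
      \<comment> \<open>Clearing the denominators \<open>B\<close> turns the numerator of the kernel
        of \<open>f\<close> into that of \<open>S\<close> minus that of \<open>B\<close>.\<close>
      have "(1 - f (zs!i) * cnj (f (zs!j))) * c i * cnj (c j) =
         ((1 - S (zs!i) * cnj (S (zs!j))) - (1 - B (zs!i) * cnj (B (zs!j)))) * e i * cnj (e j)"
        unfolding fi ei using nz by (simp add: field_simps)
      then have "(1 - f (zs!i) * cnj (f (zs!j))) / (1 - zs!i * cnj (zs!j)) * c i * cnj (c j) =
         (1 - S (zs!i) * cnj (S (zs!j))) / (1 - zs!i * cnj (zs!j)) * e i * cnj (e j) -
         (1 - B (zs!i) * cnj (B (zs!j))) / (1 - zs!i * cnj (zs!j)) * (e i * cnj (e j))"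
        by (simp add: diff_divide_distrib[symmetric] left_diff_distrib mult.assoc)
      also have "(1 - B (zs!i) * cnj (B (zs!j))) / (1 - zs!i * cnj (zs!j)) * (e i * cnj (e j)) =
         (\<Sum>k<q. (e i * \<phi> k (zs!i)) * cnj (e j * \<phi> k (zs!j)))"
        unfolding KB[OF zsn(1)[OF ij(1)] zsn(1)[OF ij(2)]] by (simp add: sum_distrib_left sum_distrib_right mult_ac)
      finally show ?thesis .
    qed
    have "(\<Sum>i<n. \<Sum>j<n. \<Sum>k<q. (e i * \<phi> k (zs!i)) * cnj (e j * \<phi> k (zs!j))) =
          (\<Sum>i<n. \<Sum>k<q. \<Sum>j<n. (e i * \<phi> k (zs!i)) * cnj (e j * \<phi> k (zs!j)))"
      by (rule sum.cong[OF refl], rule sum.swap)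
    also have "\<dots> = (\<Sum>i<n. \<Sum>k<q. (e i * \<phi> k (zs!i)) * cnj (\<Sum>j<n. e j * \<phi> k (zs!j)))"
      by (simp only: sum_distrib_left cnj_sum)
    also have "\<dots> = 0" by (simp add: sum0)
    finally have 0: "(\<Sum>i<n. \<Sum>j<n. \<Sum>k<q. (e i * \<phi> k (zs!i)) * cnj (e j * \<phi> k (zs!j))) = 0" .
    have "mat_form (pick_matrix f zs) (length zs) c =
       (\<Sum>i<n. \<Sum>j<n. (1 - S (zs!i) * cnj (S (zs!j))) / (1 - zs!i * cnj (zs!j)) * e i * cnj (e j) -
      (\<Sum>k<q. (e i * \<phi> k (zs!i)) * cnj (e j * \<phi> k (zs!j))))"
      unfolding mat_form_pick_matrix unfolding n_def[symmetric] by (intro sum.cong refl, rule entry) auto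
    also have "\<dots> = (\<Sum>i<n. \<Sum>j<n. (1 - S (zs!i) * cnj (S (zs!j))) / (1 - zs!i * cnj (zs!j)) * e i * cnj (e j))"
      using 0 by (simp only: sum_subtractf diff_zero)
    finally show "0 \<le> Re (mat_form (pick_matrix f zs) (length zs) c)"
      using schur_pick_nonneg[OF S, of "{..<n}" "\<lambda>i. zs ! i" e] zsn by simp
  qed
  then show ?thesis using cardK by simp
qed

section \<open>The lower bound\<close>

text \<open>Every point of \<open>T\<close> is enclosed once and contributes the residue of a pole
  of order at most one. The sum on the right is the divided difference of \<open>F\<close> at
  \<open>T\<close>.\<close>

lemma contour_integral_circlepath_simple_poles:
  assumes F: "F holomorphic_on ball 0 1" and r: "0 < r" "r < 1"
    and T: "finite T" "\<And>t. t \<in> T \<Longrightarrow> norm t < r"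
  shows "contour_integral (circlepath 0 r) (\<lambda>u. F u / (\<Prod>t\<in>T. u - t)) =
         2 * pi * \<i> * (\<Sum>t\<in>T. F t / (\<Prod>s\<in>T - {t}. t - s))"
proof -
  define G where "G u = F u / (\<Prod>t\<in>T. u - t)" for u
  have img: "path_image (circlepath 0 r) = sphere 0 r" using r by simp
  have "contour_integral (circlepath 0 r) G =
        2 * pi * \<i> * (\<Sum>t\<in>T. winding_number (circlepath 0 r) t * residue G t)"
  proof (rule Residue_theorem[of "ball 0 1"])
    show "G holomorphic_on ball 0 1 - T"
      unfolding G_def using T(1)
      by (intro holomorphic_intros holomorphic_on_subset[OF F]) (auto simp: prod_zero_iff)
    show "path_image (circlepath 0 r) \<subseteq> ball 0 1 - T"
      unfolding img using r T(2) by fastforce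
    show "\<forall>z. z \<notin> ball 0 1 \<longrightarrow> winding_number (circlepath 0 r) z = 0"
    proof (intro allI impI)
      fix z :: complex assume "z \<notin> ball 0 1"
      then show "winding_number (circlepath 0 r) z = 0"
        using r by (intro winding_number_zero_outside[of _ "ball 0 1"]) (auto simp: img)
    qed
  qed (use T in auto)
  also have "(\<Sum>t\<in>T. winding_number (circlepath 0 r) t * residue G t) = (\<Sum>t\<in>T. F t / (\<Prod>s\<in>T - {t}. t - s))"
  proof (rule sum.cong[OF refl])
    fix t assume t: "t \<in> T"
    have "winding_number (circlepath 0 r) t = 1"
      using T(2)[OF t] by (intro winding_number_circlepath) simp
    moreover have "residue G t = F t / (\<Prod>s\<in>T - {t}. t - s)"
    proof -
      define H where "H u = F u / (\<Prod>s\<in>T - {t}. u - s)" for u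
      have "G = (\<lambda>u. H u / (u - t))"
        using T(1) t by (auto simp: G_def H_def fun_eq_iff prod.remove[of T t])
      moreover have "residue (\<lambda>u. H u / (u - t)) t = H t"
      proof (rule residue_simple[of "ball 0 1 - (T - {t})"])
        show "open (ball 0 1 - (T - {t}))" using T(1) by (intro open_Diff finite_imp_closed) auto
        show "t \<in> ball 0 1 - (T - {t})" using T(2)[OF t] r by auto
        show "H holomorphic_on ball 0 1 - (T - {t})"
          unfolding H_def using T(1)
          by (intro holomorphic_intros holomorphic_on_subset[OF F]) (auto simp: prod_zero_iff)
      qed
      ultimately show ?thesis by (simp add: H_def)
    qed
    ultimately show "winding_number (circlepath 0 r) t * residue G t = F t / (\<Prod>s\<in>T - {t}. t - s)" by simp
  qed
  finally show ?thesis unfolding G_def .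
qed

lemma contour_integral_circlepath_cong:
  assumes "0 < r" "\<And>u. norm u = r \<Longrightarrow> F u = G u"
  shows "contour_integral (circlepath 0 r) F = contour_integral (circlepath 0 r) G"
  using assms by (intro contour_integral_cong) auto

text \<open>Taking for \<open>h\<close> the product of the remaining factors leaves only the pole at
  \<open>a\<close>, so \<open>S a * poly P a = 0\<close> and \<open>a\<close> is a root of
  \<open>P\<close>. Dividing \<open>P\<close> by this factor preserves the vanishing of the
  integrals, so repeated entries of \<open>as\<close> are counted with multiplicity.\<close>

lemma linear_factors_dvd_of_vanishing_moments:
  fixes as :: "complex list" and P :: "complex poly"
  assumes S: "S holomorphic_on ball 0 1" and r: "0 < r" "r < 1"
    and as: "\<And>a. a \<in> set as \<Longrightarrow> norm a < r \<and> S a \<noteq> 0"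
    and zero: "\<And>h :: complex poly.
      contour_integral (circlepath 0 r) (\<lambda>u. S u * poly P u * poly h u / poly (\<Prod>a\<leftarrow>as. [:- a, 1:]) u) = 0"
  shows "(\<Prod>a\<leftarrow>as. [:- a, 1:]) dvd P"
  using as zero
proof (induction as arbitrary: P)
  case (Cons a as)
  define w where "w = (\<Prod>a\<leftarrow>as. [:- a, 1:])"
  have wr: "poly w u \<noteq> 0" if "norm u = r" for u
  proof
    assume "poly w u = 0"
    then have "u \<in> set as" unfolding w_def by (auto simp: poly_prod_list prod_list_zero_iff)
    then show False using Cons.prems(1)[of u] that by auto
  qed
  have a: "norm a < r" "S a \<noteq> 0" using Cons.prems(1)[of a] by auto
  have hol: "(\<lambda>u. S u * poly P u) holomorphic_on ball 0 1"
    by (intro holomorphic_intros S poly_holomorphic_on)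
  have "0 = contour_integral (circlepath 0 r) (\<lambda>u. S u * poly P u * poly w u / poly ([:- a, 1:] * w) u)"
    using Cons.prems(2)[of w] by (simp add: w_def)
  also have "\<dots> = contour_integral (circlepath 0 r) (\<lambda>u. S u * poly P u / (\<Prod>t\<in>{a}. u - t))"
  proof (rule contour_integral_circlepath_cong[OF r(1)])
    fix u :: complex assume u: "norm u = r"
    have "poly ([:- a, 1:] * w) u = (u - a) * poly w u" by (simp add: algebra_simps)
    then show "S u * poly P u * poly w u / poly ([:- a, 1:] * w) u = S u * poly P u / (\<Prod>t\<in>{a}. u - t)"
      using wr[OF u] by (simp del: mult_pCons_left)
  qed
  also have "\<dots> = 2 * pi * \<i> * (S a * poly P a)"
    by (subst contour_integral_circlepath_simple_poles[OF hol r]) (use a in auto)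
  finally have "poly P a = 0" using a by simp
  then obtain P1 where P1: "P = [:- a, 1:] * P1" by (auto simp: poly_eq_0_iff_dvd elim: dvdE)
  have "w dvd P1"
    unfolding w_def
  proof (rule Cons.IH)
    fix h :: "complex poly"
    have "contour_integral (circlepath 0 r) (\<lambda>u. S u * poly P1 u * poly h u / poly (\<Prod>a\<leftarrow>as. [:- a, 1:]) u) =
      contour_integral (circlepath 0 r) (\<lambda>u. S u * poly P u * poly h u / poly (\<Prod>a\<leftarrow>a # as. [:- a, 1:]) u)"
    proof (rule contour_integral_circlepath_cong[OF r(1)])
      fix u :: complex assume u: "norm u = r"
      then have "u - a \<noteq> 0" using a by auto
      then show "S u * poly P1 u * poly h u / poly (\<Prod>a\<leftarrow>as. [:- a, 1:]) u =
         S u * poly P u * poly h u / poly (\<Prod>a\<leftarrow>a # as. [:- a, 1:]) u"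
        using wr[OF u] by (simp add: P1 w_def[symmetric] divide_simps) (simp add: algebra_simps)
    qed
    then show "contour_integral (circlepath 0 r) (\<lambda>u. S u * poly P1 u * poly h u / poly (\<Prod>a\<leftarrow>as. [:- a, 1:]) u) = 0"
      using Cons.prems(2)[of h] by simp
  qed (use Cons.prems in auto)
  then show ?case by (simp add: P1 w_def[symmetric] mult_dvd_mono del: mult_pCons_left)
qed simp

text \<open>Test polynomials divisible by \<open>wZ\<close> annihilate the sum over \<open>Z\<close>
  and give \<open>w dvd P\<close>. Tests that isolate a single point of \<open>Z\<close> then show,
  through \<open>jump\<close>, that the cofactor \<open>P1\<close> vanishes there; this is too many
  roots for its degree. The degree bound is conditional on \<open>P \<noteq> 0\<close> because
  \<open>as\<close> and \<open>Z\<close> may both be empty.\<close>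

lemma poly_zero_of_moment_identity:
  fixes as :: "complex list" and P :: "complex poly"
  assumes S: "S holomorphic_on ball 0 1" and r: "0 < r" "r < 1"
    and as: "\<And>a. a \<in> set as \<Longrightarrow> norm a < r \<and> S a \<noteq> 0"
    and Z: "finite Z" "\<And>z. z \<in> Z \<Longrightarrow> norm z < r"
    and jump: "\<And>z. z \<in> Z \<Longrightarrow> S z \<noteq> poly (\<Prod>a\<leftarrow>as. [:- a, 1:]) z * v z"
    and moments: "\<And>h :: complex poly.
      contour_integral (circlepath 0 r)
        (\<lambda>u. S u * poly P u * poly h u / (poly (\<Prod>a\<leftarrow>as. [:- a, 1:]) u * (\<Prod>z\<in>Z. u - z))) =
      2 * pi * \<i> * (\<Sum>z\<in>Z. poly P z * v z * poly h z / (\<Prod>s\<in>Z - {z}. z - s))"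
    and deg: "P \<noteq> 0 \<Longrightarrow> degree P < length as + card Z"
  shows "P = 0"
proof -
  define w where "w = (\<Prod>a\<leftarrow>as. [:- a, 1:])"
  have deg_w: "degree w = length as" unfolding w_def
  proof (induction as)
    case (Cons a as)
    have "(\<Prod>a\<leftarrow>as. [:- a, 1:]) \<noteq> 0" by (auto simp: prod_list_zero_iff)
    then have "degree ([:- a, 1:] * (\<Prod>a\<leftarrow>as. [:- a, 1:])) = degree [:- a, 1:] + degree (\<Prod>a\<leftarrow>as. [:- a, 1:])"
      by (intro degree_mult_eq) auto
    then show ?case using Cons by (simp del: mult_pCons_left)
  qed simp
  have wr: "poly w u \<noteq> 0" if "norm u = r" for u
  proof
    assume "poly w u = 0"
    then have "u \<in> set as" unfolding w_def by (auto simp: poly_prod_list prod_list_zero_iff)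
    then show False using as[of u] that by auto
  qed
  define wZ where "wZ = (\<Prod>z\<in>Z. [:- z, 1:])"
  have pwZ: "poly wZ u = (\<Prod>z\<in>Z. u - z)" for u by (simp add: wZ_def poly_prod)
  have wZr: "(\<Prod>z\<in>Z. u - z) \<noteq> 0" if "norm u = r" for u
    using Z that by (auto simp: prod_zero_iff)
  have "w dvd P"
    unfolding w_def
  proof (rule linear_factors_dvd_of_vanishing_moments[OF S r as])
    fix h :: "complex poly"
    have "contour_integral (circlepath 0 r) (\<lambda>u. S u * poly P u * poly h u / poly (\<Prod>a\<leftarrow>as. [:- a, 1:]) u) =
      contour_integral (circlepath 0 r)
        (\<lambda>u. S u * poly P u * poly (h * wZ) u / (poly (\<Prod>a\<leftarrow>as. [:- a, 1:]) u * (\<Prod>z\<in>Z. u - z)))"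
      using wZr wr by (intro contour_integral_circlepath_cong r(1)) (auto simp: pwZ w_def)
    also have "\<dots> = 2 * pi * \<i> * (\<Sum>z\<in>Z. poly P z * v z * poly (h * wZ) z / (\<Prod>s\<in>Z - {z}. z - s))"
      by (rule moments)
    also have "(\<Sum>z\<in>Z. poly P z * v z * poly (h * wZ) z / (\<Prod>s\<in>Z - {z}. z - s)) = 0"
      using Z(1) by (intro sum.neutral) (auto simp: pwZ prod_zero_iff)
    finally show "contour_integral (circlepath 0 r) (\<lambda>u. S u * poly P u * poly h u / poly (\<Prod>a\<leftarrow>as. [:- a, 1:]) u) = 0"
      by simp
  qed
  then obtain P1 where P1: "P = w * P1" by (elim dvdE)
  have P1Z: "poly P1 z0 = 0" if z0: "z0 \<in> Z" for z0
  proof -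
    \<comment> \<open>This \<open>h\<close> vanishes on \<open>Z\<close> except at
      \<open>z0\<close>, where it cancels the denominator; this is the content of
      \<open>pick\<close>.\<close>
    define h where "h = (\<Prod>z\<in>Z - {z0}. [:- z, 1:])"
    have ph: "poly h u = (\<Prod>z\<in>Z - {z0}. u - z)" for u by (simp add: h_def poly_prod)
    have hol: "(\<lambda>u. S u * poly P1 u * poly h u) holomorphic_on ball 0 1"
      by (intro holomorphic_intros S poly_holomorphic_on)
    have "2 * pi * \<i> * (\<Sum>z\<in>Z. S z * poly P1 z * poly h z / (\<Prod>s\<in>Z - {z}. z - s)) =
       contour_integral (circlepath 0 r) (\<lambda>u. S u * poly P1 u * poly h u / (\<Prod>z\<in>Z. u - z))"
      by (rule contour_integral_circlepath_simple_poles[OF hol r Z, symmetric])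
    also have "\<dots> = contour_integral (circlepath 0 r)
        (\<lambda>u. S u * poly P u * poly h u / (poly (\<Prod>a\<leftarrow>as. [:- a, 1:]) u * (\<Prod>z\<in>Z. u - z)))"
      using wr by (intro contour_integral_circlepath_cong r(1)) (auto simp: P1 w_def[symmetric])
    also have "\<dots> = 2 * pi * \<i> * (\<Sum>z\<in>Z. poly P z * v z * poly h z / (\<Prod>s\<in>Z - {z}. z - s))"
      by (rule moments)
    finally have "(\<Sum>z\<in>Z. S z * poly P1 z * poly h z / (\<Prod>s\<in>Z - {z}. z - s)) =
       (\<Sum>z\<in>Z. poly P z * v z * poly h z / (\<Prod>s\<in>Z - {z}. z - s))" by simp
    moreover have pick: "(\<Sum>z\<in>Z. g z * poly h z / (\<Prod>s\<in>Z - {z}. z - s)) = g z0" for g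
    proof -
      have "(\<Sum>z\<in>Z. g z * poly h z / (\<Prod>s\<in>Z - {z}. z - s)) = (\<Sum>z\<in>Z. if z = z0 then g z0 else 0)"
      proof (rule sum.cong[OF refl])
        fix z assume z: "z \<in> Z"
        have "(\<Prod>s\<in>Z - {z0}. z0 - s) \<noteq> 0" using Z(1) by (auto simp: prod_zero_iff)
        moreover have "(\<Prod>s\<in>Z - {z0}. z - s) = 0" if "z \<noteq> z0"
          using Z(1) z that by (auto simp: prod_zero_iff)
        ultimately show "g z * poly h z / (\<Prod>s\<in>Z - {z}. z - s) = (if z = z0 then g z0 else 0)"
          unfolding ph by auto
      qed
      then show ?thesis using Z(1) z0 by simp
    qed
    ultimately have "S z0 * poly P1 z0 = poly P z0 * v z0"
      using pick[of "\<lambda>z. S z * poly P1 z"] pick[of "\<lambda>z. poly P z * v z"] by simp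
    then have "(S z0 - poly w z0 * v z0) * poly P1 z0 = 0" by (simp add: P1 algebra_simps)
    then show ?thesis using jump[OF z0] by (simp add: w_def)
  qed
  show "P = 0"
  proof (rule ccontr)
    assume "P \<noteq> 0"
    then have "P1 \<noteq> 0" "w \<noteq> 0" by (auto simp: P1)
    then have "degree P1 < card Z"
      using deg[OF \<open>P \<noteq> 0\<close>] by (simp add: P1 degree_mult_eq deg_w)
    moreover have "card Z \<le> card {x. poly P1 x = 0}"
      using P1Z by (intro card_mono poly_roots_finite[OF \<open>P1 \<noteq> 0\<close>]) auto
    moreover have "card {x. poly P1 x = 0} \<le> degree P1" by (rule card_poly_roots_bound[OF \<open>P1 \<noteq> 0\<close>])
    ultimately show False by simp
  qed
qed

section \<open>Moment series, compactness and moving nodes\<close>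

text \<open>Expand \<open>1 / (1 - z i * cnj (z j))\<close> as a geometric series; the terms with
  exponent \<open>m\<close> combine to a squared modulus.\<close>

lemma gram_sums:
  fixes z c :: "'i \<Rightarrow> complex"
  assumes "\<And>i. i \<in> I \<Longrightarrow> norm (z i) < 1"
  shows "(\<lambda>m. (norm (\<Sum>i\<in>I. c i * z i ^ m))\<^sup>2) sums
    Re (\<Sum>i\<in>I. \<Sum>j\<in>I. c i * cnj (c j) / (1 - z i * cnj (z j)))"
proof -
  have "(\<lambda>m. \<Sum>i\<in>I. \<Sum>j\<in>I. c i * cnj (c j) * (z i * cnj (z j)) ^ m) sums
    (\<Sum>i\<in>I. \<Sum>j\<in>I. c i * cnj (c j) * (1 / (1 - z i * cnj (z j))))"
  proof (intro sums_sum sums_mult geometric_sums)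
    fix i j assume "i \<in> I" "j \<in> I"
    then show "norm (z i * cnj (z j)) < 1"
      using assms[of i] assms[of j] mult_strict_mono'[of "norm (z i)" 1 "norm (z j)" 1] by (simp add: norm_mult)
  qed
  then have "(\<lambda>m. Re (\<Sum>i\<in>I. \<Sum>j\<in>I. c i * cnj (c j) * (z i * cnj (z j)) ^ m)) sums
    Re (\<Sum>i\<in>I. \<Sum>j\<in>I. c i * cnj (c j) * (1 / (1 - z i * cnj (z j))))"
    by (rule sums_Re)
  moreover have "Re (\<Sum>i\<in>I. \<Sum>j\<in>I. c i * cnj (c j) * (z i * cnj (z j)) ^ m) = (norm (\<Sum>i\<in>I. c i * z i ^ m))\<^sup>2" for m
  proof -
    have "(\<Sum>i\<in>I. \<Sum>j\<in>I. c i * cnj (c j) * (z i * cnj (z j)) ^ m) = of_real ((norm (\<Sum>i\<in>I. c i * z i ^ m))\<^sup>2)"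
      unfolding complex_norm_square cnj_sum sum_product by (simp add: power_mult_distrib mult_ac)
    then show ?thesis by simp
  qed
  ultimately show ?thesis by simp
qed

lemma convergent_subsequence_finite_family:
  fixes x :: "nat \<Rightarrow> nat \<Rightarrow> 'a :: heine_borel"
  assumes "\<And>k. k < N \<Longrightarrow> bounded (range (\<lambda>s. x s k))"
  shows "\<exists>\<sigma> y. strict_mono (\<sigma> :: nat \<Rightarrow> nat) \<and> (\<forall>k<N. (\<lambda>s. x (\<sigma> s) k) \<longlonglongrightarrow> y k)"
  using assms
proof (induction N)
  case 0
  show ?case by (auto intro!: exI[of _ id] simp: strict_mono_id)
next
  case (Suc N)
  then obtain \<sigma> y where \<sigma>: "strict_mono (\<sigma> :: nat \<Rightarrow> nat)" "\<forall>k<N. (\<lambda>s. x (\<sigma> s) k) \<longlonglongrightarrow> y k" by auto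
  have "bounded (range (\<lambda>s. x (\<sigma> s) N))"
    using Suc.prems[of N] by (rule bounded_subset) auto
  then obtain l \<tau> where \<tau>: "strict_mono (\<tau> :: nat \<Rightarrow> nat)" "((\<lambda>s. x (\<sigma> s) N) \<circ> \<tau>) \<longlonglongrightarrow> l"
    using bounded_imp_convergent_subsequence by blast
  have "(\<lambda>s. x ((\<sigma> \<circ> \<tau>) s) k) \<longlonglongrightarrow> (y(N := l)) k" if "k < Suc N" for k
  proof (cases "k = N")
    case True
    then show ?thesis using \<tau>(2) by (simp add: o_def)
  next
    case False
    then have "(\<lambda>s. x (\<sigma> s) k) \<longlonglongrightarrow> y k" using that \<sigma>(2) by simp
    from LIMSEQ_subseq_LIMSEQ[OF this \<tau>(1)] show ?thesis using False by (simp add: o_def)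
  qed
  then show ?case using strict_mono_o[OF \<sigma>(1) \<tau>(1)] by blast
qed

text \<open>The list \<open>as\<close> may have repetitions and meet \<open>X\<close>. Points are
  chosen one after another from balls, which are infinite, outside a finite forbidden set.\<close>

lemma distinct_perturbation:
  fixes as :: "complex list"
  assumes "finite X" "0 < \<epsilon>"
  shows "\<exists>ts. length ts = length as \<and> distinct ts \<and> set ts \<inter> X = {} \<and> (\<forall>i<length as. dist (ts ! i) (as ! i) < \<epsilon>)"
proof (induction as)
  case (Cons a as)
  then obtain ts where ts: "length ts = length as" "distinct ts" "set ts \<inter> X = {}"
    "\<forall>i<length as. dist (ts ! i) (as ! i) < \<epsilon>" by blast
  have "infinite (ball a \<epsilon>)" using assms(2) uncountable_ball[of \<epsilon> a] countable_finite by blast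
  then have "infinite (ball a \<epsilon> - (X \<union> set ts))" using assms(1) by simp
  then obtain t where "t \<in> ball a \<epsilon> - (X \<union> set ts)" by (metis finite.emptyI ex_in_conv)
  then show ?case using ts
    by (intro exI[of _ "t # ts"]) (auto simp: nth_Cons' dist_commute)
qed simp

text \<open>On the circle each limit factor is bounded away from 0 by \<open>r - norm (a i)\<close>,
  even if several \<open>a i\<close> coincide. This makes the contour integrals converge where the
  individual residues may blow up.\<close>

lemma uniform_limit_prod_inverse:
  fixes t :: "nat \<Rightarrow> nat \<Rightarrow> complex"
  assumes "\<And>i. i < N \<Longrightarrow> (\<lambda>s. t s i) \<longlonglongrightarrow> a i" "\<And>i. i < N \<Longrightarrow> norm (a i) < r"
  shows "uniform_limit (sphere 0 r) (\<lambda>s u. \<Prod>i<N. inverse (u - t s i)) (\<lambda>u. \<Prod>i<N. inverse (u - a i)) sequentially"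
  using assms
proof (induction N)
  case 0
  then show ?case by (simp add: uniform_limit_const)
next
  case (Suc N)
  have lb: "r - norm (a i) \<le> norm (u - a i)" if "u \<in> sphere 0 r" for i u
    using that norm_triangle_ineq2[of u "a i"] by simp
  have bdd: "bounded ((\<lambda>u. \<Prod>i<M. inverse (u - a i)) ` sphere 0 r)" if "M \<le> Suc N" for M
  proof (intro compact_imp_bounded compact_continuous_image continuous_intros compact_sphere ballI)
    fix i and u :: complex assume "i \<in> {..<M}" "u \<in> sphere 0 r"
    then show "u - a i \<noteq> 0" using Suc.prems(2)[of i] that by auto
  qed
  have 1: "uniform_limit (sphere 0 r) (\<lambda>s u. inverse (u - t s N)) (\<lambda>u. inverse (u - a N)) sequentially"
  proof (rule uniform_lim_inverse[unfolded o_def])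
    have c: "uniform_limit (sphere 0 r) (\<lambda>s u. t s N) (\<lambda>u. a N) sequentially"
      unfolding uniform_limit_iff using Suc.prems(1)[of N] by (auto simp: tendsto_iff)
    show "uniform_limit (sphere 0 r) (\<lambda>s u. u - t s N) (\<lambda>u. u - a N) sequentially"
      by (intro uniform_limit_intros c)
    show "\<And>u. u \<in> sphere 0 r \<Longrightarrow> r - norm (a N) \<le> norm (u - a N)" by (rule lb)
    show "0 < r - norm (a N)" using Suc.prems(2)[of N] by simp
  qed
  have "bounded ((\<lambda>u. inverse (u - a N)) ` sphere 0 r)"
  proof (intro compact_imp_bounded compact_continuous_image continuous_intros compact_sphere ballI)
    fix u :: complex assume "u \<in> sphere 0 r"
    then show "u - a N \<noteq> 0" using Suc.prems(2)[of N] by auto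
  qed
  then show ?case
    using uniform_lim_mult[OF Suc.IH 1 bdd[of N]] Suc.prems by simp
qed

text \<open>In the application \<open>F\<close> contains the factor \<open>u ^ j\<close>, so that
  \<open>G\<close> carries a factor \<open>r ^ j\<close>.\<close>

lemma contour_integral_circlepath_perturb:
  assumes r: "0 < r" and F: "continuous_on (sphere 0 r) F"
    and v: "continuous_on (sphere 0 r) v" "continuous_on (sphere 0 r) v'"
    and G: "\<And>u. norm u = r \<Longrightarrow> norm (F u) \<le> G"
    and \<eta>: "\<And>u. norm u = r \<Longrightarrow> norm (v u - v' u) \<le> \<eta>"
  shows "norm (contour_integral (circlepath 0 r) (\<lambda>u. F u * v u) -
    contour_integral (circlepath 0 r) (\<lambda>u. F u * v' u)) \<le> G * \<eta> * (2 * pi * r)"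
proof -
  have int: "(\<lambda>u. F u * v u) contour_integrable_on circlepath 0 r"
    "(\<lambda>u. F u * v' u) contour_integrable_on circlepath 0 r"
    using r by (auto intro!: contour_integrable_continuous_circlepath continuous_intros F v)
  have r': "norm (complex_of_real r) = r" using r by simp
  have G0: "0 \<le> G" and \<eta>0: "0 \<le> \<eta>"
    using order_trans[OF norm_ge_zero G[OF r']] order_trans[OF norm_ge_zero \<eta>[OF r']] by auto
  have "((\<lambda>u. F u * v u - F u * v' u) has_contour_integral
    (contour_integral (circlepath 0 r) (\<lambda>u. F u * v u) - contour_integral (circlepath 0 r) (\<lambda>u. F u * v' u)))
    (circlepath 0 r)"
    by (intro has_contour_integral_diff has_contour_integral_integral int)
  then show ?thesis
  proof (rule has_contour_integral_bound_circlepath)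
    fix u :: complex assume "norm (u - 0) = r"
    then have u: "norm u = r" by simp
    have "norm (F u * v u - F u * v' u) = norm (F u) * norm (v u - v' u)"
      by (simp add: norm_mult right_diff_distrib[symmetric])
    also have "\<dots> \<le> G * \<eta>" by (intro mult_mono G \<eta> u G0) auto
    finally show "norm (F u * v u - F u * v' u) \<le> G * \<eta>" .
  qed (use r G0 \<eta>0 in auto)
qed

text \<open>By \<open>gram_sums\<close> the real part of the form is \<open>A - A'\<close>, so
  nonnegativity gives \<open>A' \<le> A\<close>. The decay of the plain moments bounds
  \<open>A\<close> by a geometric series with ratio \<open>r\<^sup>2\<close>, and a single term of
  \<open>A'\<close> is at most its sum.\<close>

lemma pick_moment_bound:
  assumes zs: "\<And>i. i < length zs \<Longrightarrow> norm (zs ! i) < 1"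
    and nonneg: "0 \<le> Re (mat_form (pick_matrix f zs) (length zs) c)"
    and D: "\<And>m. norm (\<Sum>i<length zs. c i * (zs ! i) ^ m) \<le> \<beta> * r ^ m" and r: "0 \<le> r" "r < 1"
  shows "(norm (\<Sum>i<length zs. c i * f (zs ! i) * (zs ! i) ^ m))\<^sup>2 \<le> \<beta>\<^sup>2 / (1 - r\<^sup>2)"
proof -
  let ?n = "length zs"
  define d where "d m = (norm (\<Sum>i<?n. c i * (zs ! i) ^ m))\<^sup>2" for m
  define e where "e m = (norm (\<Sum>i<?n. c i * f (zs ! i) * (zs ! i) ^ m))\<^sup>2" for m
  define A where "A = Re (\<Sum>i<?n. \<Sum>j<?n. c i * cnj (c j) / (1 - zs ! i * cnj (zs ! j)))"
  define A' where "A' = Re (\<Sum>i<?n. \<Sum>j<?n. (c i * f (zs ! i)) * cnj (c j * f (zs ! j)) / (1 - zs ! i * cnj (zs ! j)))"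
  have d: "d sums A" unfolding d_def A_def by (rule gram_sums) (use zs in auto)
  have e: "e sums A'" unfolding e_def A'_def by (rule gram_sums) (use zs in auto)
  have "mat_form (pick_matrix f zs) ?n c =
     (\<Sum>i<?n. \<Sum>j<?n. c i * cnj (c j) / (1 - zs ! i * cnj (zs ! j)) -
        (c i * f (zs ! i)) * cnj (c j * f (zs ! j)) / (1 - zs ! i * cnj (zs ! j)))"
    unfolding mat_form_pick_matrix
    by (intro sum.cong refl) (simp add: diff_divide_distrib[symmetric] algebra_simps)
  then have "A' \<le> A" using nonneg by (simp add: A_def A'_def sum_subtractf)
  have r2: "r\<^sup>2 < 1" using r by (simp add: power_less_one_iff)
  have geo: "(\<lambda>m. \<beta>\<^sup>2 * (r\<^sup>2) ^ m) sums (\<beta>\<^sup>2 * (1 / (1 - r\<^sup>2)))"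
    using r2 by (intro sums_mult geometric_sums) simp
  have "d m \<le> \<beta>\<^sup>2 * (r\<^sup>2) ^ m" for m
    using power_mono[OF D[of m] norm_ge_zero, of 2]
    by (simp add: d_def power_mult_distrib power_mult[symmetric] mult.commute)
  then have "A \<le> \<beta>\<^sup>2 * (1 / (1 - r\<^sup>2))" by (rule sums_le[OF _ d geo])
  moreover have "e m \<le> A'"
    using sum_le_suminf[OF sums_summable[OF e], of "{m}"] sums_unique[OF e] by (simp add: e_def)
  ultimately show ?thesis using \<open>A' \<le> A\<close> unfolding e_def by simp
qed

lemma sum_nth_distinct:
  assumes "distinct xs"
  shows "(\<Sum>i<length xs. h (xs ! i)) = (\<Sum>x\<in>set xs. h x)"
  using sum.reindex_bij_betw[OF bij_betw_nth[OF assms refl refl], of h] .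

section \<open>Negative definiteness close to the limit configuration\<close>

text \<open>The points are \<open>q + card Z\<close> perturbed nodes followed by the
  \<open>card Z\<close> jumps themselves. If no perturbation worked, normalized coefficient vectors
  with nonnegative form would have a limit point \<open>Y\<close> annihilating all limit moments;
  \<open>injective\<close> excludes this.\<close>

theorem pick_matrix_many_negative:
  assumes std: "standard_function f S B q Z W"
  shows "\<exists>zs. length zs = q + 2 * card Z \<and> distinct zs \<and> set zs \<subseteq> ball 0 1 - W \<and>
           q + card Z \<le> sq_minus (pick_matrix f zs)"
proof -
  have Z: "finite Z" "Z \<subseteq> ball 0 1" and W: "finite W" and ZW: "Z \<inter> W = {}"
    and S: "S holomorphic_on ball 0 1" and B: "blaschke_product B q"
    and ZB: "zeroset B \<subseteq> W \<union> Z" and BS: "zeroset B \<inter> zeroset S = {}"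
    and fZ: "\<And>z. z \<in> Z - zeroset B \<Longrightarrow> f z \<noteq> S z / B z"
    and f: "\<And>z. z \<in> ball 0 1 - (W \<union> Z) \<Longrightarrow> f z = S z / B z"
    using std by (auto simp: standard_function_def schur_function_def)
  obtain c0 as where c0: "norm c0 = 1" and as: "length as = q" "\<forall>a\<in>set as. norm a < 1"
    and Beq: "\<And>z. norm z \<le> 1 \<Longrightarrow> B z = c0 * (\<Prod>a\<leftarrow>as. (z - a) / (1 - cnj a * z))"
    using B unfolding blaschke_product_def by blast
  obtain zl where zl: "set zl = Z" "distinct zl" using finite_distinct_list[OF Z(1)] by blast
  have lzl: "length zl = card Z" using distinct_card[OF zl(2)] zl(1) by simp
  define N where "N = q + card Z"
  define pts where "pts = as @ zl"
  have lpts: "length pts = N" by (simp add: pts_def N_def as lzl)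
  have spts: "set pts = set as \<union> Z" by (simp add: pts_def zl)
  have npts: "norm a < 1" if "a \<in> set pts" for a using that as(2) Z(2) by (auto simp: spts)

  \<comment> \<open>The inserted 0 covers the empty list. The radius \<open>r\<close> lies halfway
    between \<open>R\<close> and 1, and \<rho> is the distance by which nodes may move while staying
    inside the circle.\<close>
  define R where "R = Max (insert 0 (norm ` set pts))"
  have R: "0 \<le> R" "R < 1" "\<And>a. a \<in> set pts \<Longrightarrow> norm a \<le> R"
    using npts by (auto simp: R_def intro!: Max_ge)
  define r where "r = (1 + R) / 2"
  define \<rho> where "\<rho> = r - R"
  have r: "0 < r" "r < 1" "0 < \<rho>" using R by (auto simp: r_def \<rho>_def)
  have ptsr: "norm a < r" if "a \<in> set pts" for a using R(3)[OF that] r(3) by (simp add: \<rho>_def)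

  have "\<forall>s. \<exists>ts. length ts = N \<and> distinct ts \<and> set ts \<inter> (W \<union> Z) = {} \<and>
      (\<forall>i<N. dist (ts ! i) (pts ! i) < \<rho> / real (Suc s))"
  proof
    fix s
    show "\<exists>ts. length ts = N \<and> distinct ts \<and> set ts \<inter> (W \<union> Z) = {} \<and>
      (\<forall>i<N. dist (ts ! i) (pts ! i) < \<rho> / real (Suc s))"
      using distinct_perturbation[of "W \<union> Z" "\<rho> / real (Suc s)" pts] W Z(1) r(3) lpts by auto
  qed
  from choice[OF this] obtain ts where "\<forall>s. length (ts s) = N \<and> distinct (ts s) \<and> set (ts s) \<inter> (W \<union> Z) = {} \<and>
      (\<forall>i<N. dist (ts s ! i) (pts ! i) < \<rho> / real (Suc s))" by blast
  then have ts: "length (ts s) = N" "distinct (ts s)" "set (ts s) \<inter> (W \<union> Z) = {}"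
    and dts: "\<And>i. i < N \<Longrightarrow> dist (ts s ! i) (pts ! i) < \<rho> / real (Suc s)" for s by auto
  have tsr: "norm x < r" if x: "x \<in> set (ts s)" for s x
  proof -
    obtain i where i: "i < N" "x = ts s ! i" using x ts(1)[of s] by (auto simp: in_set_conv_nth)
    have "norm x \<le> norm (pts ! i) + dist (ts s ! i) (pts ! i)"
      using norm_triangle_sub[of x "pts ! i"] by (simp add: i dist_norm)
    also have "norm (pts ! i) \<le> R" using R(3)[of "pts ! i"] i lpts by simp
    also have "dist (ts s ! i) (pts ! i) < \<rho>"
    proof (rule less_le_trans[OF dts[OF i(1)]])
      show "\<rho> / real (Suc s) \<le> \<rho>" using r(3) by (simp add: divide_le_eq)
    qed
    finally show ?thesis by (simp add: \<rho>_def)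
  qed
  have tlim: "(\<lambda>s. ts s ! i) \<longlonglongrightarrow> pts ! i" if "i < N" for i
  proof (rule metric_tendsto_imp_tendsto)
    show "(\<lambda>s. \<rho> * inverse (real (Suc s))) \<longlonglongrightarrow> 0"
      using tendsto_mult_left[OF LIMSEQ_inverse_real_of_nat, of \<rho>] by simp
    show "\<forall>\<^sub>F s in sequentially. dist (ts s ! i) (pts ! i) \<le> dist (\<rho> * inverse (real (Suc s))) 0"
      using dts[OF that] r(3) by (auto simp: divide_inverse abs_mult less_imp_le)
  qed

  \<comment> \<open>Here \<omega> carries the zeros of \<open>B\<close> with multiplicity, and
    \<open>U\<close> is the quotient of \<open>B\<close> by \<omega>, holomorphic in the
    disk.\<close>
  define \<omega> where "\<omega> = (\<Prod>a\<leftarrow>as. [:- a, 1:])"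
  define den where "den = (\<Prod>a\<leftarrow>as. [:1, - cnj a:])"
  define U where "U z = c0 / poly den z" for z
  have den0: "poly den z \<noteq> 0" if "norm z < 1" for z
  proof
    assume "poly den z = 0"
    then obtain a where a: "a \<in> set as" "1 = cnj a * z"
      unfolding den_def by (auto simp: poly_prod_list prod_list_zero_iff mult.commute)
    then have "1 = norm a * norm z" by (metis complex_mod_cnj norm_mult norm_one)
    moreover have "norm a * norm z < 1 * 1" using a as(2) that by (intro mult_strict_mono') auto
    ultimately show False by simp
  qed
  have BU: "B z = poly \<omega> z * U z" if "norm z < 1" for z
  proof -
    have "(\<Prod>a\<leftarrow>as. (z - a) / (1 - cnj a * z)) = poly \<omega> z / poly den z"
      unfolding \<omega>_def den_def by (induction as) (simp_all add: algebra_simps)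
    then show ?thesis using Beq[of z] that by (simp add: U_def)
  qed
  have Uhol: "U holomorphic_on ball 0 1"
    unfolding U_def using den0 by (intro holomorphic_intros poly_holomorphic_on) auto
  have Bhol: "B holomorphic_on ball 0 1"
  proof (rule holomorphic_transform)
    show "(\<lambda>z. poly \<omega> z * U z) holomorphic_on ball 0 1" by (intro holomorphic_intros poly_holomorphic_on Uhol)
  qed (simp add: BU)
  have \<omega>0: "poly \<omega> u = 0 \<longleftrightarrow> u \<in> set as" for u
    unfolding \<omega>_def by (auto simp: poly_prod_list prod_list_zero_iff)
  have Sas: "S a \<noteq> 0" if "a \<in> set as" for a
  proof -
    have "norm a < 1" using that as(2) by simp
    moreover have "B a = 0" using BU[OF \<open>norm a < 1\<close>] \<omega>0[of a] that by simp
    ultimately show ?thesis using BS by (auto simp: zeroset_def)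
  qed
  \<comment> \<open>Both kinds of jump are covered: at a zero of \<open>B\<close> the values of
    \<open>S\<close> and \<open>B\<close> do not vanish together, and elsewhere the value of
    \<open>f\<close> differs from \<open>S z / B z\<close>.\<close>
  have jump: "S z \<noteq> poly \<omega> z * (U z * f z)" if z: "z \<in> Z" for z
  proof -
    have z1: "norm z < 1" using z Z(2) by auto
    have "S z \<noteq> B z * f z"
    proof (cases "B z = 0")
      case True
      then have "z \<in> zeroset B" using z1 by (simp add: zeroset_def)
      then have "z \<notin> zeroset S" using BS by blast
      then show ?thesis using True z1 by (simp add: zeroset_def)
    next
      case False
      then have "f z \<noteq> S z / B z" using fZ[of z] z by (simp add: zeroset_def)
      then show ?thesis using False by (auto simp: field_simps)
    qed
    then show ?thesis using BU[OF z1] by (simp add: mult.assoc)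
  qed

  \<comment> \<open>The kernel with simple poles at the nodes. Its limit \<open>v0\<close> has poles
    at \<open>pts\<close> and may have multiple ones.\<close>
  define v where "v s u = (\<Prod>i<N. inverse (u - ts s ! i))" for s u
  define v0 where "v0 u = (\<Prod>i<N. inverse (u - pts ! i))" for u
  have vlim: "uniform_limit (sphere 0 r) v v0 sequentially"
    unfolding v_def v0_def by (rule uniform_limit_prod_inverse[OF tlim]) (use ptsr lpts in auto)
  have v_eq: "v s u = 1 / (\<Prod>t\<in>set (ts s). u - t)" for s u
  proof -
    have "(\<Prod>t\<in>set (ts s). u - t) = (\<Prod>i<N. u - ts s ! i)"
      using prod.reindex_bij_betw[OF bij_betw_nth[OF ts(2)[of s] refl refl], of "\<lambda>t. u - t"] ts(1)[of s] by simp
    then show ?thesis by (simp add: v_def prod_inversef[unfolded o_def] divide_inverse)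
  qed
  have v0_eq: "v0 u = 1 / (poly \<omega> u * (\<Prod>z\<in>Z. u - z))" for u
  proof -
    have "(\<Prod>i<N. u - pts ! i) = prod_list (map (\<lambda>x. u - x) pts)"
      using prod.list_conv_set_nth[of "map (\<lambda>x. u - x) pts"] lpts by (simp add: atLeast0LessThan)
    also have "\<dots> = poly \<omega> u * (\<Prod>z\<in>Z. u - z)"
      unfolding pts_def \<omega>_def zl(1)[symmetric] prod.distinct_set_conv_list[OF zl(2)]
      by (simp add: poly_prod_list o_def)
    finally show ?thesis by (simp add: v0_def prod_inversef[unfolded o_def] divide_inverse)
  qed
  have cv: "continuous_on (sphere 0 r) (v s)" for s
    unfolding v_def
  proof (intro continuous_intros ballI)
    fix i and u :: complex assume "i \<in> {..<N}" "u \<in> sphere 0 r"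
    then show "u - ts s ! i \<noteq> 0" using tsr[of "ts s ! i" s] nth_mem[of i "ts s"] ts(1)[of s] by auto
  qed
  have cv0: "continuous_on (sphere 0 r) v0"
    unfolding v0_def
  proof (intro continuous_intros ballI)
    fix i and u :: complex assume "i \<in> {..<N}" "u \<in> sphere 0 r"
    then show "u - pts ! i \<noteq> 0" using ptsr[of "pts ! i"] nth_mem[of i pts] lpts by auto
  qed
  have sph: "sphere 0 r \<subseteq> ball 0 1" using r by auto
  define J where "J F w = contour_integral (circlepath 0 r) (\<lambda>u. F u * w u)" for F w :: "complex \<Rightarrow> complex"
  \<comment> \<open>The bound is uniform in \<open>j\<close> with decay \<open>r ^ j\<close>, as
    needed for summing over all moments in \<open>pick_moment_bound\<close>.\<close>
  have J_small: "\<forall>\<^sub>F s in sequentially. \<forall>j. norm (J (\<lambda>u. F u * u ^ j) (v s) - J (\<lambda>u. F u * u ^ j) v0) \<le> \<epsilon> * r ^ j"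
    if F: "F holomorphic_on ball 0 1" and \<epsilon>: "0 < \<epsilon>" for F \<epsilon>
  proof -
    have cF: "continuous_on (sphere 0 r) F"
      using holomorphic_on_imp_continuous_on[OF F] continuous_on_subset sph by blast
    have "bounded (F ` sphere 0 r)" by (intro compact_imp_bounded compact_continuous_image cF compact_sphere)
    then obtain G where G: "G > 0" "\<And>u. u \<in> sphere 0 r \<Longrightarrow> norm (F u) \<le> G" unfolding bounded_pos by auto
    define \<eta> where "\<eta> = \<epsilon> / (G * (2 * pi * r))"
    have \<eta>: "\<eta> > 0" using \<epsilon> G r by (simp add: \<eta>_def)
    have "\<forall>\<^sub>F s in sequentially. \<forall>u\<in>sphere 0 r. dist (v s u) (v0 u) < \<eta>"
      using vlim \<eta> unfolding uniform_limit_iff by blast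
    then show ?thesis
    proof (eventually_elim, intro allI)
      fix s j assume d: "\<forall>u\<in>sphere 0 r. dist (v s u) (v0 u) < \<eta>"
      have "norm (J (\<lambda>u. F u * u ^ j) (v s) - J (\<lambda>u. F u * u ^ j) v0) \<le> (G * r ^ j) * \<eta> * (2 * pi * r)"
        unfolding J_def
      proof (rule contour_integral_circlepath_perturb[OF r(1)])
        show "continuous_on (sphere 0 r) (\<lambda>u. F u * u ^ j)" by (intro continuous_intros cF)
        show "norm (F u * u ^ j) \<le> G * r ^ j" if "norm u = r" for u
          using G(2)[of u] that r by (auto simp: norm_mult norm_power intro!: mult_right_mono)
        show "norm (v s u - v0 u) \<le> \<eta>" if "norm u = r" for u
          using d that by (auto simp: dist_norm intro: less_imp_le)
      qed (rule cv cv0)+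
      also have "\<dots> = \<epsilon> * r ^ j" using G r by (simp add: \<eta>_def field_simps)
      finally show "norm (J (\<lambda>u. F u * u ^ j) (v s) - J (\<lambda>u. F u * u ^ j) v0) \<le> \<epsilon> * r ^ j" .
    qed
  qed

  define wZ where "wZ z = (\<Prod>x\<in>Z - {z}. z - x)" for z
  \<comment> \<open>Coefficient at the point \<open>p\<close> belonging to the monomial \<open>u ^ k\<close>: the residues of
    \<open>B(u) u ^ k / \<Prod>\<^sub>i (u - t\<^sub>i)\<close> at the nodes, and minus those of its limit at the jumps.\<close>
  define g where "g s p k = (if p \<in> Z then - U p * p ^ k / wZ p
      else B p * p ^ k / (\<Prod>x\<in>set (ts s) - {p}. p - x))" for s p and k :: nat
  define d where "d j = (\<Sum>z\<in>Z. U z * f z * z ^ j / wZ z)" for j :: nat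
  \<comment> \<open>For column \<open>k\<close> of \<open>g\<close>, the \<open>m\<close>-th plain
    moment will be \<open>\<delta> s (k + m)\<close> and the one weighted by \<open>f\<close> will
    be \<open>\<mu> s (k + m)\<close>; \<mu>0 is the limit of \<mu>. By construction \<delta> tends
    to 0.\<close>
  define \<delta> where "\<delta> s j = (J (\<lambda>u. B u * u ^ j) (v s) - J (\<lambda>u. B u * u ^ j) v0) / (2 * pi * \<i>)" for s j
  define \<mu> where "\<mu> s j = J (\<lambda>u. S u * u ^ j) (v s) / (2 * pi * \<i>) - d j" for s j
  define \<mu>0 where "\<mu>0 j = J (\<lambda>u. S u * u ^ j) v0 / (2 * pi * \<i>) - d j" for j
  define zs where "zs s = ts s @ zl" for s
  have zs: "length (zs s) = q + 2 * card Z" "distinct (zs s)" "set (zs s) = set (ts s) \<union> Z" for s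
    using ts[of s] zl lzl by (auto simp: zs_def N_def)
  have zs1: "norm x < 1" if "x \<in> set (zs s)" for s x
    using that tsr[of x s] Z(2) r by (auto simp: zs(3))
  have zsD: "set (zs s) \<subseteq> ball 0 1 - W" for s
    using zs1[of _ s] ts(3)[of s] ZW by (auto simp: zs(3))
  have Jts: "J F (v s) = 2 * pi * \<i> * (\<Sum>t\<in>set (ts s). F t / (\<Prod>x\<in>set (ts s) - {t}. t - x))"
    if "F holomorphic_on ball 0 1" for F s
    using contour_integral_circlepath_simple_poles[OF that r(1,2), of "set (ts s)"] tsr[of _ s]
    by (simp add: J_def v_eq)
  have sum_zs: "(\<Sum>i<length (zs s). h (zs s ! i)) = (\<Sum>t\<in>set (ts s). h t) + (\<Sum>z\<in>Z. h z)" for s and h :: "complex \<Rightarrow> complex"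
    unfolding sum_nth_distinct[OF zs(2)] zs(3) using ts(3)[of s] Z(1) by (subst sum.union_disjoint) auto
  \<comment> \<open>In the limit kernel \<omega> cancels against \<open>B\<close>, leaving simple
    poles at the jumps only. Their residues are what \<open>g\<close> subtracts there.\<close>
  have g\<delta>: "(\<Sum>i<length (zs s). g s (zs s ! i) k * (zs s ! i) ^ m) = \<delta> s (k + m)" for s k m
  proof -
    have "J (\<lambda>u. B u * u ^ (k + m)) v0 = contour_integral (circlepath 0 r) (\<lambda>u. U u * u ^ (k + m) / (\<Prod>z\<in>Z. u - z))"
      unfolding J_def
    proof (rule contour_integral_circlepath_cong[OF r(1)])
      fix u :: complex assume u: "norm u = r"
      then have "poly \<omega> u \<noteq> 0" using ptsr[of u] by (auto simp: \<omega>0 spts)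
      then show "B u * u ^ (k + m) * v0 u = U u * u ^ (k + m) / (\<Prod>z\<in>Z. u - z)"
        using BU[of u] u r by (simp add: v0_eq)
    qed
    also have "\<dots> = 2 * pi * \<i> * (\<Sum>z\<in>Z. U z * z ^ (k + m) / wZ z)"
      unfolding wZ_def by (rule contour_integral_circlepath_simple_poles[OF _ r(1,2) Z(1)])
        (use ptsr spts in \<open>auto intro!: holomorphic_intros Uhol\<close>)
    finally have 1: "J (\<lambda>u. B u * u ^ (k + m)) v0 = 2 * pi * \<i> * (\<Sum>z\<in>Z. U z * z ^ (k + m) / wZ z)" .
    have 2: "J (\<lambda>u. B u * u ^ (k + m)) (v s) =
       2 * pi * \<i> * (\<Sum>t\<in>set (ts s). B t * t ^ (k + m) / (\<Prod>x\<in>set (ts s) - {t}. t - x))"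
      by (rule Jts) (intro holomorphic_intros Bhol)
    have 3: "(\<Sum>t\<in>set (ts s). g s t k * t ^ m) = (\<Sum>t\<in>set (ts s). B t * t ^ (k + m) / (\<Prod>x\<in>set (ts s) - {t}. t - x))"
      using ts(3)[of s] by (intro sum.cong refl) (auto simp: g_def power_add)
    have 4: "(\<Sum>z\<in>Z. g s z k * z ^ m) = - (\<Sum>z\<in>Z. U z * z ^ (k + m) / wZ z)"
      unfolding sum_negf[symmetric] by (intro sum.cong refl) (auto simp: g_def power_add)
    show ?thesis
      unfolding sum_zs[of "\<lambda>p. g s p k * p ^ m"] 3 4 \<delta>_def 1 2 by (simp add: right_diff_distrib[symmetric])
  qed
  have g\<mu>: "(\<Sum>i<length (zs s). g s (zs s ! i) k * f (zs s ! i) * (zs s ! i) ^ m) = \<mu> s (k + m)" for s k m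
  proof -
    have 2: "J (\<lambda>u. S u * u ^ (k + m)) (v s) =
       2 * pi * \<i> * (\<Sum>t\<in>set (ts s). S t * t ^ (k + m) / (\<Prod>x\<in>set (ts s) - {t}. t - x))"
      by (rule Jts) (intro holomorphic_intros S)
    have 3: "(\<Sum>t\<in>set (ts s). g s t k * f t * t ^ m) = (\<Sum>t\<in>set (ts s). S t * t ^ (k + m) / (\<Prod>x\<in>set (ts s) - {t}. t - x))"
    proof (rule sum.cong[OF refl])
      fix t assume t: "t \<in> set (ts s)"
      \<comment> \<open>The nodes avoid \<open>W \<union> Z\<close>, so
        \<open>f t = S t / B t\<close> and the factor \<open>B t\<close> in \<open>g\<close> turns
        \<open>f\<close> into \<open>S\<close>.\<close>
      then have t': "t \<notin> W" "t \<notin> Z" "norm t < 1" using ts(3)[of s] tsr[OF t] r by auto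
      then have "B t \<noteq> 0" using ZB by (auto simp: zeroset_def)
      then have "B t * f t = S t" using f[of t] t' by simp
      then show "g s t k * f t * t ^ m = S t * t ^ (k + m) / (\<Prod>x\<in>set (ts s) - {t}. t - x)"
        using t' by (auto simp: g_def power_add)
    qed
    have 4: "(\<Sum>z\<in>Z. g s z k * f z * z ^ m) = - d (k + m)"
      unfolding d_def sum_negf[symmetric] by (intro sum.cong refl) (auto simp: g_def power_add)
    show ?thesis
      unfolding sum_zs[of "\<lambda>p. g s p k * f p * p ^ m"] 3 4 \<mu>_def 2 by simp
  qed
  have \<delta>_small: "\<forall>\<^sub>F s in sequentially. \<forall>j. norm (\<delta> s j) \<le> \<epsilon> * r ^ j" if "0 < \<epsilon>" for \<epsilon>
  proof -
    have "0 < \<epsilon> * (2 * pi)" using that by simp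
    from J_small[OF Bhol this] show ?thesis
    proof eventually_elim
      case (elim s)
      then show ?case by (auto simp: \<delta>_def norm_divide norm_mult divide_le_eq mult_ac)
    qed
  qed
  have \<mu>_lim: "(\<lambda>s. \<mu> s j) \<longlonglongrightarrow> \<mu>0 j" for j
  proof -
    have "(\<lambda>s. J (\<lambda>u. S u * u ^ j) (v s)) \<longlonglongrightarrow> J (\<lambda>u. S u * u ^ j) v0"
      unfolding tendsto_iff
    proof (intro allI impI)
      fix \<epsilon> :: real assume "\<epsilon> > 0"
      then have "0 < \<epsilon> / 2 / r ^ j" using r by simp
      from J_small[OF S this]
      show "\<forall>\<^sub>F s in sequentially. dist (J (\<lambda>u. S u * u ^ j) (v s)) (J (\<lambda>u. S u * u ^ j) v0) < \<epsilon>"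
      proof eventually_elim
        case (elim s)
        then have "norm (J (\<lambda>u. S u * u ^ j) (v s) - J (\<lambda>u. S u * u ^ j) v0) \<le> \<epsilon> / 2 / r ^ j * r ^ j" by blast
        also have "\<dots> < \<epsilon>" using r \<open>\<epsilon> > 0\<close> by simp
        finally show ?case by (simp add: dist_norm)
      qed
    qed
    then show ?thesis unfolding \<mu>_def \<mu>0_def by (intro tendsto_intros) auto
  qed

  \<comment> \<open>Read \<open>Y\<close> as the coefficients of a polynomial \<open>P\<close> of
    degree below \<open>N\<close>. Vanishing for all \<open>m\<close> extends by linearity to every
    test polynomial \<open>h\<close>, which is the moment identity with \<open>U z * f z\<close> as
    values at the jumps.\<close>
  have injective: "Y k = 0" if Y: "\<And>m. (\<Sum>k<N. Y k * \<mu>0 (k + m)) = 0" and k: "k < N" for Y k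
  proof -
    define P where "P = (\<Sum>k<N. monom (Y k) k)"
    have coeffP: "coeff P i = (if i < N then Y i else 0)" for i
      by (simp add: P_def coeff_sum if_distrib cong: if_cong)
    have polyP: "poly P u = (\<Sum>k<N. Y k * u ^ k)" for u by (simp add: P_def poly_sum poly_monom)
    have "P = 0"
    proof (rule poly_zero_of_moment_identity[OF S r(1,2), of as Z "\<lambda>z. U z * f z"])
      show "norm a < r \<and> S a \<noteq> 0" if "a \<in> set as" for a using that ptsr Sas by (auto simp: spts)
      show "finite Z" by fact
      show "norm z < r" if "z \<in> Z" for z using that ptsr by (auto simp: spts)
      show "S z \<noteq> poly (\<Prod>a\<leftarrow>as. [:- a, 1:]) z * (U z * f z)" if "z \<in> Z" for z
        using jump[OF that] by (simp add: \<omega>_def)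
      show "degree P < length as + card Z" if "P \<noteq> 0"
      proof (rule ccontr)
        assume "\<not> degree P < length as + card Z"
        then have "coeff P (degree P) = 0" by (simp add: coeffP N_def as)
        then show False using that by simp
      qed
      fix h :: "complex poly"
      have int: "(\<lambda>u. S u * u ^ j * v0 u) contour_integrable_on circlepath 0 r" for j
        using r continuous_on_subset[OF holomorphic_on_imp_continuous_on[OF S] sph]
        by (auto intro!: contour_integrable_continuous_circlepath continuous_intros cv0)
      have "contour_integral (circlepath 0 r)
        (\<lambda>u. S u * poly P u * poly h u / (poly (\<Prod>a\<leftarrow>as. [:- a, 1:]) u * (\<Prod>z\<in>Z. u - z))) =
        contour_integral (circlepath 0 r)
        (\<lambda>u. \<Sum>m\<le>degree h. \<Sum>k<N. (coeff h m * Y k) * (S u * u ^ (k + m) * v0 u))"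
      proof (rule contour_integral_circlepath_cong[OF r(1)])
        fix u :: complex
        have "S u * poly P u * poly h u / (poly (\<Prod>a\<leftarrow>as. [:- a, 1:]) u * (\<Prod>z\<in>Z. u - z)) =
          (S u * v0 u) * (poly h u * poly P u)"
          by (simp add: v0_eq \<omega>_def[symmetric])
        also have "poly h u * poly P u = (\<Sum>m\<le>degree h. \<Sum>k<N. (coeff h m * Y k) * u ^ (k + m))"
          unfolding poly_altdef[of h] polyP sum_product by (intro sum.cong refl) (simp add: power_add mult_ac)
        finally show "S u * poly P u * poly h u / (poly (\<Prod>a\<leftarrow>as. [:- a, 1:]) u * (\<Prod>z\<in>Z. u - z)) =
          (\<Sum>m\<le>degree h. \<Sum>k<N. (coeff h m * Y k) * (S u * u ^ (k + m) * v0 u))"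
          by (simp add: sum_distrib_left mult_ac)
      qed
      also have "\<dots> = (\<Sum>m\<le>degree h. \<Sum>k<N. (coeff h m * Y k) * J (\<lambda>u. S u * u ^ (k + m)) v0)"
      proof (rule contour_integral_unique, intro has_contour_integral_sum has_contour_integral_lmul)
        show "((\<lambda>u. S u * u ^ (k + m) * v0 u) has_contour_integral J (\<lambda>u. S u * u ^ (k + m)) v0) (circlepath 0 r)" for k m
          unfolding J_def using int by (rule has_contour_integral_integral)
      qed auto
      also have "\<dots> = (\<Sum>m\<le>degree h. coeff h m * (\<Sum>k<N. Y k * ((2 * pi * \<i>) * (\<mu>0 (k + m) + d (k + m)))))"
        by (simp add: \<mu>0_def sum_distrib_left mult.assoc)
      \<comment> \<open>The part with \<mu>0 vanishes by the assumption on \<open>Y\<close>; the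
        part with \<open>d\<close> is regrouped as a sum over the jumps.\<close>
      also have "\<dots> = (\<Sum>m\<le>degree h. coeff h m * ((2 * pi * \<i>) * (\<Sum>k<N. Y k * \<mu>0 (k + m)) + (2 * pi * \<i>) * (\<Sum>k<N. Y k * d (k + m))))"
        by (simp only: sum_distrib_left sum.distrib distrib_left mult.left_commute)
      also have "\<dots> = 2 * pi * \<i> * (\<Sum>m\<le>degree h. coeff h m * (\<Sum>k<N. Y k * d (k + m)))"
        by (simp add: Y sum_distrib_left mult.left_commute)
      also have "(\<Sum>m\<le>degree h. coeff h m * (\<Sum>k<N. Y k * d (k + m))) =
         (\<Sum>m\<le>degree h. \<Sum>k<N. \<Sum>z\<in>Z. (coeff h m * z ^ m) * (Y k * z ^ k) * (U z * f z / wZ z))"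
        by (simp add: d_def sum_distrib_left power_add mult_ac)
      also have "\<dots> = (\<Sum>m\<le>degree h. \<Sum>z\<in>Z. \<Sum>k<N. (coeff h m * z ^ m) * (Y k * z ^ k) * (U z * f z / wZ z))"
        by (rule sum.cong[OF refl], rule sum.swap)
      also have "\<dots> = (\<Sum>z\<in>Z. \<Sum>m\<le>degree h. \<Sum>k<N. (coeff h m * z ^ m) * (Y k * z ^ k) * (U z * f z / wZ z))"
        by (rule sum.swap)
      also have "\<dots> = (\<Sum>z\<in>Z. poly P z * (U z * f z) * poly h z / (\<Prod>s\<in>Z - {z}. z - s))"
      proof (rule sum.cong[OF refl])
        fix z
        have "(\<Sum>m\<le>degree h. \<Sum>k<N. (coeff h m * z ^ m) * (Y k * z ^ k) * (U z * f z / wZ z)) =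
          (poly h z * poly P z) * (U z * f z / wZ z)"
          unfolding poly_altdef[of h] polyP sum_product by (simp only: sum_distrib_right)
        then show "(\<Sum>m\<le>degree h. \<Sum>k<N. (coeff h m * z ^ m) * (Y k * z ^ k) * (U z * f z / wZ z)) =
          poly P z * (U z * f z) * poly h z / (\<Prod>s\<in>Z - {z}. z - s)" by (simp add: wZ_def)
      qed
      finally show "contour_integral (circlepath 0 r)
        (\<lambda>u. S u * poly P u * poly h u / (poly (\<Prod>a\<leftarrow>as. [:- a, 1:]) u * (\<Prod>z\<in>Z. u - z))) =
        2 * pi * \<i> * (\<Sum>z\<in>Z. poly P z * (U z * f z) * poly h z / (\<Prod>s\<in>Z - {z}. z - s))" .
    qed
    then show ?thesis using coeffP[of k] k by simp
  qed

  have "\<exists>s. N \<le> sq_minus (pick_matrix f (zs s))"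
  proof (rule ccontr)
    assume contra: "\<not> (\<exists>s. N \<le> sq_minus (pick_matrix f (zs s)))"
    have "\<forall>s. \<exists>x. (\<exists>k<N. x k \<noteq> 0) \<and>
      0 \<le> Re (mat_form (pick_matrix f (zs s)) (length (zs s)) (\<lambda>i. \<Sum>k<N. g s (zs s ! i) k * x k))"
    proof (rule allI, rule ccontr)
      fix s
      assume "\<not> (\<exists>x. (\<exists>k<N. x k \<noteq> 0) \<and>
        0 \<le> Re (mat_form (pick_matrix f (zs s)) (length (zs s)) (\<lambda>i. \<Sum>k<N. g s (zs s ! i) k * x k)))"
      then have "card {..<N} \<le> sq_minus (pick_matrix f (zs s))"
        by (intro sq_minus_ge[OF pick_matrix_carrier pick_matrix_hermitian, where g = "\<lambda>i. g s (zs s ! i)"])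
          (auto simp: not_le)
      then show False using contra by auto
    qed
    from choice[OF this] obtain x where x: "\<And>s. \<exists>k<N. x s k \<noteq> 0"
      and pos: "\<And>s. 0 \<le> Re (mat_form (pick_matrix f (zs s)) (length (zs s))
        (\<lambda>i. \<Sum>k<N. g s (zs s ! i) k * x s k))"
      by blast
    define X where "X s = (\<Sum>k<N. norm (x s k))" for s
    have X: "0 < X s" for s
    proof -
      obtain k where "k < N" "x s k \<noteq> 0" using x by blast
      then show ?thesis unfolding X_def by (intro sum_pos2[of _ k]) auto
    qed
    \<comment> \<open>Normalizing the sum of moduli to 1 keeps the vectors in a compact set and
      prevents a zero limit.\<close>
    define y where "y s k = x s k / of_real (X s)" for s k
    have ysum: "(\<Sum>k<N. norm (y s k)) = 1" for s
      using X[of s] by (simp add: y_def norm_divide sum_divide_distrib[symmetric] X_def[symmetric])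
    have y1: "norm (y s k) \<le> 1" if "k < N" for s k
      using member_le_sum[of k "{..<N}" "\<lambda>k. norm (y s k)"] that ysum[of s] by simp
    \<comment> \<open>Nonnegativity of the form bounds the moments weighted by \<open>f\<close>
      through the plain moments, which are combinations of \<delta> and hence small.\<close>
    have M0: "(\<lambda>s. \<Sum>k<N. y s k * \<mu> s (k + m)) \<longlonglongrightarrow> 0" for m
      unfolding tendsto_iff
    proof (intro allI impI)
      fix \<epsilon> :: real assume \<epsilon>: "\<epsilon> > 0"
      have r2: "0 < 1 - r\<^sup>2" using r by (simp add: power_less_one_iff)
      \<comment> \<open>Chosen so that dividing by \<open>1 - r\<^sup>2\<close> in
        \<open>pick_moment_bound\<close> leaves exactly the square of
        \<open>X s * (\<epsilon> / 2)\<close>.\<close>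
      define \<epsilon>' where "\<epsilon>' = \<epsilon> / 2 * sqrt (1 - r\<^sup>2)"
      have "\<epsilon>' > 0" using \<epsilon> r2 by (simp add: \<epsilon>'_def)
      from \<delta>_small[OF this]
      show "\<forall>\<^sub>F s in sequentially. dist (\<Sum>k<N. y s k * \<mu> s (k + m)) 0 < \<epsilon>"
      proof eventually_elim
        case (elim s)
        have swap: "(\<Sum>i<length (zs s). (\<Sum>k<N. g s (zs s ! i) k * x s k) * h i) =
           (\<Sum>k<N. x s k * (\<Sum>i<length (zs s). g s (zs s ! i) k * h i))" for h :: "nat \<Rightarrow> complex"
          unfolding sum_distrib_left sum_distrib_right by (subst sum.swap) (simp add: mult_ac)
        have "(norm (\<Sum>i<length (zs s). (\<Sum>k<N. g s (zs s ! i) k * x s k) * f (zs s ! i) * (zs s ! i) ^ m))\<^sup>2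
          \<le> (X s * \<epsilon>')\<^sup>2 / (1 - r\<^sup>2)"
        proof (rule pick_moment_bound[OF _ pos])
          show "norm (zs s ! i) < 1" if "i < length (zs s)" for i using zs1[of "zs s ! i" s] that by simp
          fix m
          have "norm (\<Sum>i<length (zs s). (\<Sum>k<N. g s (zs s ! i) k * x s k) * (zs s ! i) ^ m) =
            norm (\<Sum>k<N. x s k * \<delta> s (k + m))" by (simp add: swap g\<delta>)
          also have "\<dots> \<le> (\<Sum>k<N. norm (x s k) * (\<epsilon>' * r ^ m))"
          proof (rule sum_norm_le)
            fix k
            have "norm (\<delta> s (k + m)) \<le> \<epsilon>' * r ^ (k + m)" using elim by blast
            also have "\<dots> \<le> \<epsilon>' * r ^ m"
              using r \<open>\<epsilon>' > 0\<close> by (intro mult_left_mono power_decreasing) auto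
            finally show "norm (x s k * \<delta> s (k + m)) \<le> norm (x s k) * (\<epsilon>' * r ^ m)"
              by (simp add: norm_mult mult_left_mono)
          qed
          also have "\<dots> = X s * \<epsilon>' * r ^ m" by (simp add: X_def sum_distrib_right mult.assoc)
          finally show "norm (\<Sum>i<length (zs s). (\<Sum>k<N. g s (zs s ! i) k * x s k) * (zs s ! i) ^ m)
            \<le> X s * \<epsilon>' * r ^ m" .
        qed (use r in auto)
        also have "\<dots> = (X s * (\<epsilon> / 2))\<^sup>2"
        proof -
          have "(X s * \<epsilon>')\<^sup>2 = (X s * (\<epsilon> / 2))\<^sup>2 * (1 - r\<^sup>2)"
            unfolding \<epsilon>'_def mult.assoc[symmetric] power_mult_distrib[of _ "sqrt _"] using r2 by simp
          then show ?thesis using r2 by simp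
        qed
        finally have "norm (\<Sum>i<length (zs s). (\<Sum>k<N. g s (zs s ! i) k * x s k) * f (zs s ! i) * (zs s ! i) ^ m)
          \<le> X s * (\<epsilon> / 2)"
          by (rule power2_le_imp_le) (use X[of s] \<epsilon> in simp)
        also have "(\<Sum>i<length (zs s). (\<Sum>k<N. g s (zs s ! i) k * x s k) * f (zs s ! i) * (zs s ! i) ^ m) =
          (\<Sum>k<N. x s k * \<mu> s (k + m))"
          using swap[of "\<lambda>i. f (zs s ! i) * (zs s ! i) ^ m"] g\<mu>[of s _ m] by (simp add: mult.assoc)
        also have "\<dots> = of_real (X s) * (\<Sum>k<N. y s k * \<mu> s (k + m))"
          using X[of s] by (simp add: y_def sum_distrib_left)
        finally have "norm (\<Sum>k<N. y s k * \<mu> s (k + m)) \<le> \<epsilon> / 2"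
          using X[of s] by (simp add: norm_mult)
        then show ?case using \<epsilon> by simp
      qed
    qed
    have "bounded (range (\<lambda>s. y s k))" if "k < N" for k
      using y1[OF that] by (auto intro!: boundedI)
    then obtain \<sigma> Y where \<sigma>: "strict_mono (\<sigma> :: nat \<Rightarrow> nat)" and Y: "\<And>k. k < N \<Longrightarrow> (\<lambda>s. y (\<sigma> s) k) \<longlonglongrightarrow> Y k"
      using convergent_subsequence_finite_family[of N y] by blast
    \<comment> \<open>Along the subsequence the same expression tends to the limit moment and, by
      \<open>M0\<close>, to 0.\<close>
    have "(\<Sum>k<N. Y k * \<mu>0 (k + m)) = 0" for m
    proof (rule LIMSEQ_unique)
      have "(\<lambda>s. \<mu> (\<sigma> s) j) \<longlonglongrightarrow> \<mu>0 j" for j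
        using LIMSEQ_subseq_LIMSEQ[OF \<mu>_lim \<sigma>] by (simp add: o_def)
      then show "(\<lambda>s. \<Sum>k<N. y (\<sigma> s) k * \<mu> (\<sigma> s) (k + m)) \<longlonglongrightarrow> (\<Sum>k<N. Y k * \<mu>0 (k + m))"
        using Y by (intro tendsto_intros) auto
      show "(\<lambda>s. \<Sum>k<N. y (\<sigma> s) k * \<mu> (\<sigma> s) (k + m)) \<longlonglongrightarrow> 0"
        using LIMSEQ_subseq_LIMSEQ[OF M0 \<sigma>] by (simp add: o_def)
    qed
    then have Y0: "Y k = 0" if "k < N" for k using injective that by blast
    have "(\<lambda>s. \<Sum>k<N. norm (y (\<sigma> s) k)) \<longlonglongrightarrow> (\<Sum>k<N. norm (Y k))"
      using Y by (intro tendsto_intros) auto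
    then have "(\<Sum>k<N. norm (Y k)) = 1" using ysum LIMSEQ_unique[OF _ tendsto_const[of "1::real"]] by auto
    then show False using Y0 by simp
  qed
  then obtain s where "N \<le> sq_minus (pick_matrix f (zs s))" by blast
  then show ?thesis using zs[of s] zsD[of s] unfolding N_def by blast
qed

section \<open>Membership in the class and the bounds for \<open>N_index\<close>\<close>

text \<open>Imposing \<open>c k = 0\<close> for every index leaves only the zero form. This gives
  the lower bound for \<open>N_index\<close>: reaching \<kappa> negative eigenvalues takes at least
  \<kappa> points.\<close>

lemma sq_minus_pick_matrix_le_length: "sq_minus (pick_matrix f zs) \<le> length zs"
  using sq_minus_le[OF pick_matrix_carrier[of f zs] pick_matrix_hermitian, of "{..<length zs}" "\<lambda>k j. if k = j then 1 else 0"]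
  by (simp add: mat_form_def if_distrib[of "\<lambda>x. x * _"] cong: if_cong)

theorem theorem3p1:
  fixes f S B :: "complex \<Rightarrow> complex" and q :: nat and Z W :: "complex set"
  assumes "standard_function f S B q Z W"
  shows "in_S_kappa (ball 0 1 - W) f (q + card Z)
    \<and> q + card Z \<le> N_index (ball 0 1 - W) f (q + card Z)
    \<and> N_index (ball 0 1 - W) f (q + card Z) \<le> q + 2 * card Z"
proof -
  define D where "D = ball 0 1 - W"
  define \<kappa> where "\<kappa> = q + card Z"
  have W: "finite W" "W \<subseteq> ball 0 1" using assms by (auto simp: standard_function_def)
  have le: "sq_minus (pick_matrix f zs) \<le> \<kappa>" if "distinct zs" "set zs \<subseteq> D" for zs
    using sq_minus_pick_matrix_le[OF assms] that by (simp add: D_def \<kappa>_def)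
  obtain zs where zs: "length zs = q + 2 * card Z" "distinct zs" "set zs \<subseteq> D" "\<kappa> \<le> sq_minus (pick_matrix f zs)"
    using pick_matrix_many_negative[OF assms] by (auto simp: D_def \<kappa>_def)
  then have eq: "sq_minus (pick_matrix f zs) = \<kappa>" using le[of zs] by simp
  have "in_S_kappa D f \<kappa>"
    unfolding in_S_kappa_def
  proof (intro conjI)
    show "\<exists>\<Lambda>. \<Lambda> \<subseteq> ball 0 1 \<and> (\<forall>z\<in>ball 0 1. \<not> z islimpt \<Lambda>) \<and> D = ball 0 1 - \<Lambda>"
      using W by (intro exI[of _ W]) (auto simp: D_def islimpt_finite)
  qed (use le zs eq in auto)
  moreover have vals: "finite {sq_minus (pick_matrix f zs) |zs. length zs = n \<and> distinct zs \<and> set zs \<subseteq> D}" for n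
    by (rule finite_subset[of _ "{..\<kappa>}"]) (use le in auto)
  \<comment> \<open>\<open>Max\<close> in \<open>kn\<close> is informative only over a finite
    nonempty set; the infinite domain provides \<open>n\<close> distinct points for every
    \<open>n\<close>.\<close>
  have "infinite (ball (0::complex) 1)" using uncountable_ball[of 1 "0::complex"] countable_finite by auto
  then have "infinite D" using W by (simp add: D_def)
  have nonempty: "{sq_minus (pick_matrix f zs) |zs. length zs = n \<and> distinct zs \<and> set zs \<subseteq> D} \<noteq> {}" for n
  proof -
    obtain T where "T \<subseteq> D" "finite T" "card T = n" using infinite_arbitrarily_large[OF \<open>infinite D\<close>] by blast
    moreover then obtain xs where "set xs = T" "distinct xs" using finite_distinct_list by blast
    ultimately show ?thesis using distinct_card by fastforce
  qed
  have kn_le: "kn D f n \<le> min \<kappa> n" for n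
  proof -
    have "sq_minus (pick_matrix f xs) \<le> min \<kappa> (length xs)" if "distinct xs" "set xs \<subseteq> D" for xs
      using le[OF that] sq_minus_pick_matrix_le_length[of f xs] by simp
    then have "x \<le> min \<kappa> n"
      if "x \<in> {sq_minus (pick_matrix f zs) |zs. length zs = n \<and> distinct zs \<and> set zs \<subseteq> D}" for x
      using that by blast
    then show ?thesis
      unfolding kn_def using Max_in[OF vals[of n] nonempty[of n]] by blast
  qed
  have "\<kappa> \<le> kn D f (q + 2 * card Z)"
    unfolding kn_def using vals zs eq by (intro Max_ge) auto
  then have kn_eq: "kn D f (q + 2 * card Z) = \<kappa>" using kn_le[of "q + 2 * card Z"] by simp
  \<comment> \<open>The least index is attained because \<open>q + 2 * card Z\<close> is a witness;
    with \<open>kn_le\<close> it is at least \<kappa>.\<close>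
  then have "kn D f (N_index D f \<kappa>) = \<kappa>" unfolding N_index_def by (rule LeastI)
  then have "\<kappa> \<le> N_index D f \<kappa>" using kn_le[of "N_index D f \<kappa>"] by simp
  moreover have "N_index D f \<kappa> \<le> q + 2 * card Z" unfolding N_index_def by (rule Least_le) (rule kn_eq)
  ultimately show ?thesis by (simp add: D_def \<kappa>_def)
qed

end
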